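(* Let $v\in B^0$, and let $\tau(v)=\prod_{i=1}^{q}z_{c'_{i-1}}(k'_i)\in B^0$ be its dual. Then $$\zeta(\sigma_r^{b,2}(v);\alpha)=\sum_{\substack{r_1+\cdots+r_{q}=r\\ r_i\ge0}}H^{*}_{(\{r_i\}_{i=1}^{q})}(\tau(v);\alpha)$$ for all integers $r\ge0$ and all $\alpha\in\mathbb{C}$ with $\mathrm{Re}(\alpha)>0$.
   Context: Notation. All summation indices, $p,q,r,r_i,k_i,m_i,M^{(i)}_j$, etc., are integers. For $c\in\{0,1\}$ the symbol $<_{c}$ means $<$ if $c=1$ and $\le$ if $c=0$. $(a)_m$ is the Pochhammer symbol: $(a)_0=1$, $(a)_m=a(a+1)\cdots(a+m-1)$ for $m\ge1$. Words. Let $x_0,x_1,x_{-1}$ be non-commuting variables and, for $c\in\{0,1\}$, $k\ge1$, put $z_c(k):=x_c x_{-1}^{k-1}$. Products $\prod$ of words are taken in order from left to right. Let $$B^0=\Bigl\{\prod_{i=1}^{p}z_{c_{i-1}}(k_i)\ \Big|\ p\ge0,\ c_0=1,\ c_i\in\{0,1\},\ k_i\ge1\ (1\le i\le p-1),\ k_p\ge2\Bigr\},$$ where the empty product ($p=0$) is $1$, and let $V^0$ be the $\mathbb{Q}$-vector space with basis $B^0$. All maps below are defined on $B^0$ and extended $\mathbb{Q}$-linearly to $V^0$. Dual. $\tau:B^0\to B^0$ is given by $\tau(1)=1$ and $\tau(x_{1}x_{e_1}\cdots x_{e_{n-1}}x_{-1})=x_{1}x_{-e_{n-1}}\cdots x_{-e_1}x_{-1}$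 for $n\ge1$, $e_i\in\{-1,0,1\}$. Thus $\tau(v)$ can be written as $\prod_{i=1}^{q}z_{c'_{i-1}}(k'_i)$ with $q\ge0$, $c'_0=1$, $c'_i\in\{0,1\}$, $k'_i\ge1$ ($1\le i\le q-1$), $k'_q\ge2$. Multiple Hurwitz zeta values. For $\alpha\in\mathbb{C}\setminus\{0,-1,-2,\ldots\}$: $\zeta(1;\alpha)=1$ and, for $p\ge1$, $$\zeta\Bigl(\prod_{i=1}^{p}z_{c_{i-1}}(k_i);\alpha\Bigr)=\sum_{0\le m_1<_{c_1}\cdots<_{c_{p-1}}m_p<\infty}\ \prod_{i=1}^{p}\frac{1}{(m_i+\alpha)^{k_i}}.$$ The map $H^*$. For $q\ge1$, integers $r_1,\ldots,r_q\ge0$, $\mathrm{Re}(\alpha)>0$, and with $c_q:=1$, $$H^{*}_{(\{r_i\}_{i=1}^{q})}\Bigl(\prod_{i=1}^{q}z_{c_{i-1}}(k_i);\alpha\Bigr)=\sum\frac{(m_q+1)!}{(\alpha)_{m_q+1}}\prod_{i=1}^{q}\Bigl\{\Bigl(\prod_{j=1}^{r_i}\frac{1}{M^{(i)}_j+\alpha}\Bigr)\frac{1}{(m_i+1)^{k_i}}\Bigr\},$$ where the sum is over all integers $m_1,\ldots,m_q\ge0$ and $M^{(i)}_j$ ($1\le i\le q$, $1\le j\le r_i$) satisfying $$0\le M^{(1)}_1\le\cdots\le M^{(1)}_{r_1}<_{1-c_1}m_1\quad\text{and}\quad m_{i-1}<_{c_{i-1}}M^{(i)}_1\le\cdots\le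 M^{(i)}_{r_i}<_{1-c_i}m_i\quad(2\le i\le q);$$ when $r_i=0$ the $i$-th condition is read as $m_{i-1}<_{c_{i-1}}m_i$ for $i\ge2$ and as $0\le m_1$ for $i=1$. Also $H^*(1;\alpha)=1$. The map $\sigma^{b,2}_r$ ($r\ge0$). $\sigma_r^{b,2}(1)=1$ and, for $p\ge1$, $$\sigma_r^{b,2}\Bigl(\prod_{i=1}^{p}z_{c_{i-1}}(k_i)\Bigr)=\sum_{\substack{r_1+\cdots+r_p=r\\ r_i\ge0}}\Bigl\{\prod_{i=1}^{p}\binom{k_i+r_i-1}{r_i}\Bigr\}\prod_{i=1}^{p}z_{c_{i-1}}(k_i+r_i).$$ Convention. If $v=1$ (so $q=0$) the right-hand side of the identity is read as $1$. *)

theory Defs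
  imports "HOL-Analysis.Analysis" "HOL-Library.Poly_Mapping"
begin

datatype letter = X0 | X1 | Xm1  \<comment> \<open>\<open>Xm1\<close> is $x_{-1}$\<close>

fun opp :: "letter \<Rightarrow> letter" where
  "opp X0 = X0"
| "opp X1 = Xm1"
| "opp Xm1 = X1"

text \<open>
  The index \<open>c \<in> {0,1}\<close> is a Boolean (\<open>True\<close> for 1), and the word
  $\prod_{i=1}^p z_{c_{i-1}}(k_i)$ is given by the list of the pairs $(c_{i-1},k_i)$.
  Lists are numbered from 0, so entry \<open>i\<close> of such a list is $(c_i,k_{i+1})$.
\<close>

definition z :: "bool \<Rightarrow> nat \<Rightarrow> letter list" where
  "z c k = (if c then X1 else X0) # replicate (k - 1) Xm1"

definition zprod :: "(bool \<times> nat) list \<Rightarrow> letter list" where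
  "zprod b = concat (map (\<lambda>(c, k). z c k) b)"

definition admissible :: "(bool \<times> nat) list \<Rightarrow> bool" where
  "admissible b \<longleftrightarrow> b = [] \<or>
     (fst (hd b) \<and> (\<forall>(c, k)\<in>set b. k \<ge> 1) \<and> snd (last b) \<ge> 2)"

definition B0 :: "letter list set" where
  "B0 = zprod ` {b. admissible b}"

text \<open>The inverse of \<open>zprod\<close> on \<open>B0\<close>; see \<open>blocks_zprod\<close> below.\<close>

definition blocks :: "letter list \<Rightarrow> (bool \<times> nat) list" where
  "blocks = the_inv_into {b. admissible b} zprod"

definition V0 :: "(letter list \<Rightarrow>\<^sub>0 rat) set" where
  "V0 = {u. Poly_Mapping.keys u \<subseteq> B0}"

definition tau :: "letter list \<Rightarrow> letter list" where
  "tau w = (if w = [] then [] else X1 # rev (map opp (butlast (tl w))) @ [Xm1])"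

definition compositions :: "nat \<Rightarrow> nat \<Rightarrow> nat list set" where
  "compositions p r = {rs. length rs = p \<and> sum_list rs = r}"

text \<open>\<open>lt c\<close> is the relation $<_c$.\<close>

definition lt :: "bool \<Rightarrow> nat \<Rightarrow> nat \<Rightarrow> bool" where
  "lt c m n \<longleftrightarrow> (if c then m < n else m \<le> n)"

text \<open>
  The multiple series here and in \<open>Hstar\<close> are unordered sums over tuples of indices (as lists);
  \<open>infsum\<close> would be 0 for a series that is not absolutely convergent. The empty product
  needs no separate case here; see \<open>zeta_word_Nil\<close> below.
\<close>

definition zeta_word :: "letter list \<Rightarrow> complex \<Rightarrow> complex" where
  "zeta_word w \<alpha> = (let b = blocks w; p = length b in
     \<Sum>\<^sub>\<infinity>m\<in>{m :: nat list. length m = p \<and>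
              (\<forall>i. Suc i < p \<longrightarrow> lt (fst (b ! Suc i)) (m ! i) (m ! Suc i))}.
       \<Prod>i<p. 1 / (of_nat (m ! i) + \<alpha>) ^ snd (b ! i))"

text \<open>The $\mathbb{Q}$-linear extension of \<open>zeta_word\<close>.\<close>

definition zeta :: "(letter list \<Rightarrow>\<^sub>0 rat) \<Rightarrow> complex \<Rightarrow> complex" where
  "zeta u \<alpha> = (\<Sum>w\<in>Poly_Mapping.keys u. of_rat (Poly_Mapping.lookup u w) * zeta_word w \<alpha>)"

text \<open>
  In \<open>Hstar_chain c r m M i\<close>, \<open>c j\<close> is $c_j$, while \<open>m ! i\<close>, \<open>M ! i\<close>, \<open>r ! i\<close> stand for
  $m_{i+1}$, $(M^{(i+1)}_j)_j$, $r_{i+1}$; it is the condition numbered $i+1$.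
\<close>

definition Hstar_chain ::
  "(nat \<Rightarrow> bool) \<Rightarrow> nat list \<Rightarrow> nat list \<Rightarrow> nat list list \<Rightarrow> nat \<Rightarrow> bool" where
  "Hstar_chain c r m M i \<longleftrightarrow>
     (if r ! i = 0 then i \<ge> 1 \<longrightarrow> lt (c i) (m ! (i - 1)) (m ! i)
      else (i \<ge> 1 \<longrightarrow> lt (c i) (m ! (i - 1)) (hd (M ! i))) \<and>
           sorted (M ! i) \<and>
           lt (\<not> c (Suc i)) (last (M ! i)) (m ! i))"

definition Hstar :: "nat list \<Rightarrow> letter list \<Rightarrow> complex \<Rightarrow> complex" where
  "Hstar r w \<alpha> = (if w = [] then 1 else
     let b = blocks w; q = length b; c = (\<lambda>i. if i < q then fst (b ! i) else True) in
     \<Sum>\<^sub>\<infinity>(m, M)\<in>{(m :: nat list, M :: nat list list). length m = q \<and> length M = q \<and>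
                  (\<forall>i<q. length (M ! i) = r ! i \<and> Hstar_chain c r m M i)}.
       fact (last m + 1) / pochhammer \<alpha> (last m + 1) *
       (\<Prod>i<q. (\<Prod>j<r ! i. 1 / (of_nat (M ! i ! j) + \<alpha>)) *
               (1 / of_nat (m ! i + 1) ^ snd (b ! i))))"

text \<open>The map $\sigma^{b,2}_r$ on words, with values in \<open>V0\<close> (see \<open>sigma_b2_in_V0\<close>).\<close>

definition sigma_b2 :: "nat \<Rightarrow> letter list \<Rightarrow> (letter list \<Rightarrow>\<^sub>0 rat)" where
  "sigma_b2 r w = (if w = [] then Poly_Mapping.single [] 1 else
     let b = blocks w; p = length b in
     \<Sum>rs\<in>compositions p r.
       Poly_Mapping.single
         (zprod (map (\<lambda>i. (fst (b ! i), snd (b ! i) + rs ! i)) [0..<p]))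
         (\<Prod>i<p. of_nat ((snd (b ! i) + rs ! i - 1) choose (rs ! i))))"

lemma zprod_simps:
  "zprod [] = []"
  "zprod ((c, k) # b) = (if c then X1 else X0) # replicate (k - 1) Xm1 @ zprod b"
  by (simp_all add: zprod_def z_def)

lemma zprod_hd: "zprod b = [] \<or> hd (zprod b) \<noteq> Xm1"
  by (cases b) (auto simp: zprod_simps split: if_splits)

lemma replicate_append_inj:
  assumes "replicate m a @ xs = replicate n a @ ys"
    and "xs = [] \<or> hd xs \<noteq> a" "ys = [] \<or> hd ys \<noteq> a"
  shows "m = n \<and> xs = ys"
  using assms
proof (induction m arbitrary: n)
  case 0 then show ?case by (cases n) auto
next
  case (Suc m) then show ?case by (cases n) auto
qed

lemma zprod_inj:
  assumes "zprod b = zprod b'" "\<forall>(c, k)\<in>set b. k \<ge> 1" "\<forall>(c, k)\<in>set b'. k \<ge> 1"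
  shows "b = b'"
  using assms
proof (induction b arbitrary: b')
  case Nil
  then show ?case by (cases b') (auto simp: zprod_simps)
next
  case (Cons x b)
  obtain c k where x: "x = (c, k)" by force
  obtain c' k' b'' where b': "b' = (c', k') # b''"
    using Cons.prems(1) x by (cases b') (auto simp: zprod_simps)
  have c: "c = c'" and e: "replicate (k - 1) Xm1 @ zprod b = replicate (k' - 1) Xm1 @ zprod b''"
    using Cons.prems(1) x b' by (auto simp: zprod_simps split: if_splits)
  have "k - 1 = k' - 1" "zprod b = zprod b''"
    using replicate_append_inj[OF e zprod_hd zprod_hd] by auto
  with Cons c x b' show ?case by auto
qed

lemma inj_on_zprod: "inj_on zprod {b. admissible b}"
  by (intro inj_onI zprod_inj) (auto simp: admissible_def)

lemma blocks_zprod: "admissible b \<Longrightarrow> blocks (zprod b) = b"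
  by (simp add: blocks_def the_inv_into_f_f inj_on_zprod)

lemma zprod_blocks: "w \<in> B0 \<Longrightarrow> admissible (blocks w) \<and> zprod (blocks w) = w"
  by (auto simp: B0_def blocks_zprod)

lemma zprod_append_Xm1:
  assumes "b \<noteq> []" "\<forall>(c, k)\<in>set b. k \<ge> 1"
  shows "\<exists>b'. zprod b @ [Xm1] = zprod b' \<and> b' \<noteq> [] \<and> (\<forall>(c, k)\<in>set b'. k \<ge> 1) \<and>
    fst (hd b') = fst (hd b) \<and> snd (last b') \<ge> 2"
proof -
  obtain b0 c k where b: "b = b0 @ [(c, k)]" using assms(1) by (metis rev_exhaust surj_pair)
  with assms have k: "k \<ge> 1" by auto
  have "zprod b @ [Xm1] = zprod (b0 @ [(c, Suc k)])"
    using k by (simp add: b zprod_def z_def Suc_diff_le replicate_append_same flip: replicate_Suc)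
  then show ?thesis using assms b by (intro exI[of _ "b0 @ [(c, Suc k)]"]) (cases b0; auto)
qed

lemma zprod_exists:
  "\<exists>b. X1 # u = zprod b \<and> b \<noteq> [] \<and> (\<forall>(c, k)\<in>set b. k \<ge> 1) \<and> fst (hd b)"
proof (induction u rule: rev_induct)
  case Nil
  show ?case by (rule exI[of _ "[(True, 1)]"]) (simp add: zprod_simps)
next
  case (snoc l u)
  then obtain b where b: "X1 # u = zprod b" "b \<noteq> []" "\<forall>(c, k)\<in>set b. k \<ge> 1" "fst (hd b)"
    by blast
  show ?case
  proof (cases "l = Xm1")
    case True
    with zprod_append_Xm1[OF b(2,3)] b show ?thesis
      by (metis append_Cons)
  next
    case False
    then have "X1 # u @ [l] = zprod (b @ [(l = X1, 1)])"
      using b(1) by (cases l) (auto simp: zprod_def z_def)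
    with b show ?thesis by (intro exI[of _ "b @ [(l = X1, 1)]"]) auto
  qed
qed

lemma B0_iff: "w \<in> B0 \<longleftrightarrow> w = [] \<or> (\<exists>u. w = X1 # u @ [Xm1])"
proof
  assume "w \<in> B0"
  then obtain b where b: "admissible b" "w = zprod b" by (auto simp: B0_def)
  show "w = [] \<or> (\<exists>u. w = X1 # u @ [Xm1])"
  proof (cases "b = []")
    case False
    then obtain k b1 where 1: "b = (True, k) # b1" using b by (cases b) (auto simp: admissible_def)
    from False obtain b0 c l where 2: "b = b0 @ [(c, l)]" by (metis rev_exhaust surj_pair)
    with b have "l \<ge> 2" by (auto simp: admissible_def)
    then obtain n where "l - 1 = Suc n" by (metis Suc_diff_Suc Suc_le_lessD numeral_2_eq_2 One_nat_def)
    then have l: "w = zprod b0 @ (if c then X1 else X0) # replicate n Xm1 @ [Xm1]"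
      using b(2) 2 by (simp add: zprod_def z_def replicate_append_same)
    have "hd w = X1" using b 1 by (simp add: zprod_simps)
    moreover obtain y where "w = y @ [Xm1]" "y \<noteq> []"
      using l by (intro that[of "zprod b0 @ (if c then X1 else X0) # replicate n Xm1"]) auto
    ultimately show ?thesis by (cases y) auto
  qed (use b in \<open>simp add: zprod_simps\<close>)
next
  assume "w = [] \<or> (\<exists>u. w = X1 # u @ [Xm1])"
  then show "w \<in> B0"
  proof
    assume "w = []"
    then show ?thesis by (auto simp: B0_def admissible_def zprod_simps intro!: image_eqI[of _ _ "[]"])
  next
    assume "\<exists>u. w = X1 # u @ [Xm1]"
    then obtain u where w: "w = X1 # u @ [Xm1]" by blast
    obtain b where b: "X1 # u = zprod b" "b \<noteq> []" "\<forall>(c, k)\<in>set b. k \<ge> 1" "fst (hd b)"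
      using zprod_exists by blast
    obtain b' where "w = zprod b'" "admissible b'"
      using zprod_append_Xm1[OF b(2,3)] b(1,4) w unfolding admissible_def by (metis append_Cons)
    then show ?thesis by (auto simp: B0_def)
  qed
qed

lemma tau_in_B0: "w \<in> B0 \<Longrightarrow> tau w \<in> B0"
  by (auto simp: B0_iff tau_def)

lemma finite_compositions: "finite (compositions p r)"
proof (rule finite_subset)
  show "compositions p r \<subseteq> {rs. set rs \<subseteq> {..r} \<and> length rs = p}"
    by (auto simp: compositions_def dest: member_le_sum_list)
qed (simp add: finite_lists_length_eq)

lemma sigma_b2_in_V0:
  assumes "w \<in> B0" shows "sigma_b2 r w \<in> V0"
proof (cases "w = []")
  case True
  then show ?thesis using assms by (simp add: sigma_b2_def V0_def)
next
  case False
  define b where "b = blocks w"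
  have b: "admissible b" "b \<noteq> []"
    using zprod_blocks[OF assms] False by (auto simp: b_def zprod_simps)
  have *: "zprod (map (\<lambda>i. (fst (b ! i), snd (b ! i) + rs ! i)) [0..<length b]) \<in> B0" for rs
  proof -
    have "\<forall>i<length b. snd (b ! i) \<ge> 1" "fst (b ! 0)" "snd (b ! (length b - 1)) \<ge> 2"
      using b by (auto simp: admissible_def hd_conv_nth last_conv_nth all_set_conv_all_nth
          split_beta)
    then show ?thesis using b(2)
      by (auto simp: B0_def admissible_def hd_map last_map trans_le_add1 hd_upt last_upt
          intro!: imageI)
  qed
  have "Poly_Mapping.keys (sigma_b2 r w) \<subseteq> (\<Union>rs\<in>compositions (length b) r.
      {zprod (map (\<lambda>i. (fst (b ! i), snd (b ! i) + rs ! i)) [0..<length b])})"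
    using False unfolding sigma_b2_def Let_def b_def[symmetric] if_False
    by (auto dest!: subsetD[OF Poly_Mapping.keys_sum] split: if_splits)
  with * show ?thesis by (auto simp: V0_def)
qed

lemma zeta_word_Nil: "zeta_word [] \<alpha> = 1"
proof -
  have "blocks [] = []" using blocks_zprod[of "[]"] by (simp add: admissible_def zprod_simps)
  then have "zeta_word [] \<alpha> = infsum (\<lambda>_. 1) {[] :: nat list}"
    unfolding zeta_word_def Let_def by (intro infsum_cong_neutral) auto
  then show ?thesis by simp
qed

end

theory Submission imports Defs begin

text \<open>
  Summing over \<open>r\<close> against powers of a small \<open>x\<close> reduces the identity to its case \<open>r = 0\<close> with
  \<open>\<alpha> - x\<close> in place of \<open>\<alpha>\<close>. On the left, the binomial coefficients in \<open>sigma_b2\<close> are the Taylor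
  coefficients of \<open>1 / (m + \<alpha> - x)\<^sup>k\<close>. On the right, the intervals in which the indices
  \<open>M\<^sup>(\<^sup>i\<^sup>)\<close> vary are consecutive and fill \<open>{0..m\<^sub>q}\<close>; summing over all \<open>M\<close> and all compositions of
  \<open>r\<close> gives the complete homogeneous symmetric polynomial of degree \<open>r\<close> in the numbers
  \<open>1 / (j + \<alpha>)\<close>, \<open>j \<le> m\<^sub>q\<close>, so that the factor \<open>1 / (\<alpha>)\<^sub>n\<close> with \<open>n = m\<^sub>q + 1\<close> becomes
  \<open>1 / (\<alpha> - x)\<^sub>n\<close> in the generating function.

  The case \<open>r = 0\<close> says that the Hurwitz series of a word \<open>w\<close> is the sum over the chains of the dual
  word, with exponents on \<open>m + 1\<close>, weighted by \<open>n! / (\<alpha>)\<^sub>n\<close>. It is proved by connected sums. The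
  quantity \<open>connector \<alpha> m n\<close>, which is \<open>n! / (m + \<alpha>)\<^sub>n\<close>, satisfies for each letter \<open>e\<close> an identity
  between a sum over the indices that may follow \<open>m\<close> through \<open>e\<close> and a sum over the indices that may
  follow \<open>n\<close> through the opposite letter (\<open>connector_transport\<close>); it comes from telescoping. In a double
  sum over a path for a word \<open>u\<close> ending at \<open>m\<close> and a path for a word \<open>u'\<close> ending at \<open>n\<close>, coupled by
  \<open>connector \<alpha> m n\<close>, this moves the last letter of \<open>u\<close>, replaced by its opposite, to the end of
  \<open>u'\<close> (\<open>connected_sum_transport\<close>). Starting from \<open>u = w\<close> and an empty \<open>u'\<close>, all letters are moved
  and the dual of \<open>w\<close> is built up (\<open>path_sum_duality\<close>).

  Every interchange of summations is justified by comparison with the same expression in which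
  \<open>\<alpha>\<close> is replaced by a positive real \<open>\<beta>\<close>, such as \<open>Re \<alpha>\<close>: its terms are nonnegative and bound the
  absolute values of the original ones. The comparison also works for the Taylor coefficients
  (\<open>dominated\<close>), which gives the power series a positive radius of convergence and lets their
  coefficients be compared (\<open>coefficientwise_duality\<close>).
\<close>

unbundle no vec_syntax and fps_syntax

section \<open>Paths indexed by letters\<close>

text \<open>
  The shift \<open>\<alpha>\<close> enters the estimates only through these lower bounds. For complex \<open>\<alpha>\<close> the real part
  can serve as \<open>\<beta>\<close>, and a positive real \<open>\<alpha>\<close> is its own minorant; the algebra is thus done once for
  both fields.
\<close>

definition minorant :: "real \<Rightarrow> 'a::real_normed_field \<Rightarrow> bool" where
  "minorant \<beta> \<alpha> \<longleftrightarrow> \<beta> > 0 \<and> (\<forall>n. real n + \<beta> \<le> norm (of_nat n + \<alpha>))"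

lemma minorant_refl: "\<beta> > 0 \<Longrightarrow> minorant \<beta> (\<beta> :: real)"
  by (simp add: minorant_def)

lemma minorant_Re: "Re \<alpha> > 0 \<Longrightarrow> minorant (Re \<alpha>) \<alpha>"
  unfolding minorant_def using complex_Re_le_cmod[of "of_nat n + \<alpha>" for n] by simp

lemma minorant_one: "minorant 1 (1 :: 'a::real_normed_field)"
  unfolding minorant_def using norm_of_nat[of "Suc n" for n, where ?'a = 'a] by (simp add: add.commute)

lemma minorant_nonzero: "minorant \<beta> \<alpha> \<Longrightarrow> of_nat n + \<alpha> \<noteq> 0"
proof -
  assume "minorant \<beta> \<alpha>"
  then have "0 < real n + \<beta>" "real n + \<beta> \<le> norm (of_nat n + \<alpha>)"
    by (auto simp: minorant_def add_nonneg_pos)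
  then show ?thesis by auto
qed

lemma minorant_pos: "minorant \<beta> \<alpha> \<Longrightarrow> \<beta> > 0"
  by (simp add: minorant_def)

lemma minorant_self: "minorant \<beta> \<alpha> \<Longrightarrow> minorant \<beta> \<beta>"
  by (simp add: minorant_def)

text \<open>
  The indices of the nested sums are attached to letters rather than to blocks: one index per letter,
  where \<open>x\<^sub>1\<close> and \<open>x\<^sub>0\<close> open a new summation (strict or weak) and \<open>x\<^sub>-\<^sub>1\<close> repeats the current index,
  which raises an exponent by one.
\<close>

fun step :: "letter \<Rightarrow> nat \<Rightarrow> nat \<Rightarrow> bool" where
  "step X1 m a \<longleftrightarrow> m < a"
| "step X0 m a \<longleftrightarrow> m \<le> a"
| "step Xm1 m a \<longleftrightarrow> m = a"

lemma finite_step: "finite {m. step e m a}"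
  by (cases e) auto

text \<open>
  All indices are larger by one than in the series: \<open>0\<close> is the starting point of a path, before any
  letter, and the index \<open>m\<close> of the series is represented by \<open>Suc m\<close>. The weight at \<open>0\<close> is \<open>0\<close> so that
  a nonempty word gives no path ending at \<open>0\<close>. For \<open>\<alpha> = 1\<close> the weight is \<open>1 / n\<close>, which is the
  weight \<open>1 / (m + 1)\<close> of the dual side.
\<close>

definition wt :: "'a::real_normed_field \<Rightarrow> nat \<Rightarrow> 'a" where
  "wt \<alpha> a = (case a of 0 \<Rightarrow> 0 | Suc m \<Rightarrow> 1 / (of_nat m + \<alpha>))"

lemma wt_simps [simp]: "wt \<alpha> 0 = 0" "wt \<alpha> (Suc m) = 1 / (of_nat m + \<alpha>)"
  by (simp_all add: wt_def)

lemma wt_one: "wt 1 n = 1 / of_nat n"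
  by (cases n) (simp_all add: add.commute)

lemma norm_wt_le: "minorant \<beta> \<alpha> \<Longrightarrow> norm (wt \<alpha> a) \<le> wt \<beta> a"
proof (cases a)
  case (Suc m)
  assume "minorant \<beta> \<alpha>"
  then have "real m + \<beta> > 0" "real m + \<beta> \<le> norm (of_nat m + \<alpha>)"
    by (auto simp: minorant_def add_nonneg_pos)
  then show ?thesis unfolding Suc wt_simps norm_divide norm_one of_nat_id
    by (intro divide_left_mono mult_pos_pos) linarith+
qed simp

lemma wt_nonneg: "\<beta> > 0 \<Longrightarrow> wt \<beta> a \<ge> (0 :: real)"
  by (cases a) auto

definition path_sum :: "'a::real_normed_field \<Rightarrow> letter list \<Rightarrow> nat \<Rightarrow> 'a" where
  "path_sum \<alpha> w =
     foldl (\<lambda>f e a. wt \<alpha> a * (\<Sum>m | step e m a. f m)) (\<lambda>m. of_bool (m = 0)) w"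

lemma path_sum_Nil [simp]: "path_sum \<alpha> [] m = of_bool (m = 0)"
  by (simp add: path_sum_def)

lemma path_sum_snoc:
  "path_sum \<alpha> (w @ [e]) a = wt \<alpha> a * (\<Sum>m | step e m a. path_sum \<alpha> w m)"
  by (simp add: path_sum_def)

lemma path_sum_0: "w \<noteq> [] \<Longrightarrow> path_sum \<alpha> w 0 = 0"
  by (cases w rule: rev_cases) (simp_all add: path_sum_snoc)

lemma path_sum_nonneg: "\<beta> > 0 \<Longrightarrow> path_sum \<beta> w m \<ge> (0 :: real)"
  by (induction w arbitrary: m rule: rev_induct)
    (auto simp: path_sum_snoc intro!: mult_nonneg_nonneg wt_nonneg sum_nonneg)

lemma norm_path_sum_le:
  assumes "minorant \<beta> \<alpha>" shows "norm (path_sum \<alpha> w m) \<le> path_sum \<beta> w m"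
proof (induction w arbitrary: m rule: rev_induct)
  case (snoc e w)
  show ?case unfolding path_sum_snoc norm_mult
    by (intro mult_mono norm_wt_le assms order.trans[OF norm_sum] sum_mono snoc wt_nonneg
        minorant_pos[OF assms] norm_ge_zero)
qed simp

lemma pochhammer_nonzero:
  assumes "minorant \<beta> \<alpha>" shows "pochhammer (of_nat m + \<alpha>) n \<noteq> 0"
proof
  assume "pochhammer (of_nat m + \<alpha>) n = 0"
  then obtain k where "of_nat m + \<alpha> = - of_nat k" by (auto simp: pochhammer_eq_0_iff)
  then have "of_nat (m + k) + \<alpha> = 0" by (simp add: algebra_simps eq_neg_iff_add_eq_0)
  with minorant_nonzero[OF assms] show False by blast
qed

section \<open>The connector\<close>

text \<open>
  In terms of the Gamma function this is \<open>\<Gamma>(m + \<alpha>) n! / \<Gamma>(m + \<alpha> + n)\<close>, the connector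
  \<open>m! n! / (m + n)!\<close> of Seki and Yamamoto with \<open>m\<close> shifted to \<open>m + \<alpha> - 1\<close>. It is \<open>1\<close> for \<open>n = 0\<close>
  and the weight \<open>n! / (\<alpha>)\<^sub>n\<close> of \<open>Hstar\<close> for \<open>m = 0\<close>.
\<close>

definition connector :: "'a::real_normed_field \<Rightarrow> nat \<Rightarrow> nat \<Rightarrow> 'a" where
  "connector \<alpha> m n = fact n / pochhammer (of_nat m + \<alpha>) n"

lemma connector_0 [simp]: "connector \<alpha> m 0 = 1"
  by (simp add: connector_def)

lemma connector_nonneg: "\<beta> > 0 \<Longrightarrow> connector \<beta> m n \<ge> (0 :: real)"
  by (auto simp: connector_def intro!: divide_nonneg_nonneg pochhammer_nonneg add_nonneg_pos)

lemma connector_Suc: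
  "connector \<alpha> m (Suc n) = connector \<alpha> m n * (of_nat (Suc n) / (of_nat (m + n) + \<alpha>))"
  by (simp add: connector_def pochhammer_Suc divide_simps add_ac)

lemma norm_connector_le:
  assumes "minorant \<beta> \<alpha>" shows "norm (connector \<alpha> m n) \<le> connector \<beta> m n"
proof (induction n)
  case (Suc n)
  have "norm (of_nat (Suc n) / (of_nat (m + n) + \<alpha>)) \<le> of_nat (Suc n) / (of_nat (m + n) + \<beta>)"
  proof -
    have "real (m + n) + \<beta> > 0" "real (m + n) + \<beta> \<le> norm (of_nat (m + n) + \<alpha>)"
      using assms unfolding minorant_def by (auto simp: add_nonneg_pos simp del: of_nat_add)
    then show ?thesis unfolding norm_divide norm_of_nat
      by (intro divide_left_mono mult_pos_pos) linarith+
  qed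
  then show ?case
    unfolding connector_Suc norm_mult
    using Suc assms by (intro mult_mono connector_nonneg minorant_pos) auto
qed simp

lemma field_identity_left:
  fixes a p f n :: "'a::field"
  assumes "a \<noteq> 0" "p \<noteq> 0"
  shows "f * (a + n) / (a * p) - f / p = n * (1 / a * (f / p))"
proof -
  have "f / p = f * a / (a * p)" using assms by simp
  then have "f * (a + n) / (a * p) - f / p = (f * (a + n) - f * a) / (a * p)"
    by (simp only: diff_divide_distrib)
  then show ?thesis by (simp add: algebra_simps)
qed

text \<open>
  The first of two telescoping relations, obtained from
  \<open>a (a + 1)\<^sub>n = (a)\<^sub>n (a + n)\<close> with \<open>a = j + \<alpha>\<close>.
\<close>

lemma connector_diff_left:
  assumes "minorant \<beta> \<alpha>" and n: "n > 0"
  shows "wt \<alpha> (Suc j) * connector \<alpha> (Suc j) n =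
    (connector \<alpha> j n - connector \<alpha> (Suc j) n) / of_nat n"
proof -
  have nz: "of_nat k + \<alpha> \<noteq> 0" for k by (rule minorant_nonzero[OF assms(1)])
  have p: "pochhammer (of_nat j + \<alpha>) n \<noteq> 0" "pochhammer (of_nat (Suc j) + \<alpha>) n \<noteq> 0"
    by (rule pochhammer_nonzero[OF assms(1)])+
  have e: "(of_nat j + \<alpha>) * pochhammer (of_nat (Suc j) + \<alpha>) n =
     pochhammer (of_nat j + \<alpha>) n * (of_nat j + \<alpha> + of_nat n)"
    by (metis pochhammer_Suc pochhammer_rec add.commute add.left_commute of_nat_Suc)
  have q: "fact n / pochhammer (of_nat j + \<alpha>) n =
      fact n * (of_nat j + \<alpha> + of_nat n) / ((of_nat j + \<alpha>) * pochhammer (of_nat (Suc j) + \<alpha>) n)"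
    unfolding e using p nz[of "j + n"] by (simp add: add_ac)
  have "fact n / pochhammer (of_nat j + \<alpha>) n - fact n / pochhammer (of_nat (Suc j) + \<alpha>) n =
      of_nat n * (1 / (of_nat j + \<alpha>) * (fact n / pochhammer (of_nat (Suc j) + \<alpha>) n))"
    unfolding q using p nz[of j] by (intro field_identity_left) (simp_all add: add_ac)
  then show ?thesis using n by (simp add: connector_def)
qed

lemma field_identity:
  fixes x y c :: "'a::field"
  assumes "x \<noteq> 0" "y \<noteq> 0" "x + y \<noteq> 0"
  shows "1 / x * (c * (x / (x + y))) = (c - c * (x / (x + y))) / y"
proof -
  have "c - c * (x / (x + y)) = c * y / (x + y)"
    using assms by (simp add: diff_divide_eq_iff algebra_simps)
  then show ?thesis using assms by simp
qed

lemma connector_diff_right: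
  assumes "minorant \<beta> \<alpha>"
  shows "wt 1 (Suc k) * connector \<alpha> (Suc j) (Suc k) =
    (connector \<alpha> (Suc j) k - connector \<alpha> (Suc j) (Suc k)) / (of_nat j + \<alpha>)"
proof -
  have nz: "of_nat k + \<alpha> \<noteq> 0" for k by (rule minorant_nonzero[OF assms(1)])
  have *: "of_nat (Suc j + k) + \<alpha> = of_nat (Suc k) + (of_nat j + \<alpha>)" by simp
  have "of_nat (Suc k) + (of_nat j + \<alpha>) \<noteq> 0" using nz[of "Suc j + k"] * by metis
  then show ?thesis
    unfolding connector_Suc wt_one * using nz[of j]
    by (intro field_identity) (simp_all del: of_nat_Suc)
qed

lemma connector_LIMSEQ_left:
  assumes "minorant \<beta> \<alpha>" and n: "n > 0"
  shows "(\<lambda>j. connector \<alpha> j n) \<longlonglongrightarrow> 0"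
proof -
  note b = minorant_pos[OF assms(1)]
  obtain k where k: "n = Suc k" using n by (cases n) auto
  have up: "connector \<beta> j n \<le> fact n * (1 / (real j + \<beta>)) / \<beta> ^ k" for j
  proof -
    have "pochhammer (real j + 1 + \<beta>) k \<ge> \<beta> ^ k"
      unfolding pochhammer_prod using b
      using prod_mono[of "{0..<k}" "\<lambda>_. \<beta>" "\<lambda>i. real j + 1 + \<beta> + real i"] by simp
    then have "(real j + \<beta>) * \<beta> ^ k \<le> pochhammer (real j + \<beta>) n"
      using b unfolding k pochhammer_rec by (intro mult_left_mono) (auto simp: add_ac)
    then show ?thesis unfolding connector_def
      using b by (simp add: divide_simps add_nonneg_pos pochhammer_pos mult.commute)
  qed
  have lim: "(\<lambda>j. 1 / (\<beta> + real j)) \<longlonglongrightarrow> 0"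
    by (intro tendsto_divide_0[OF tendsto_const] filterlim_at_top_imp_at_infinity
        filterlim_tendsto_add_at_top[OF tendsto_const filterlim_real_sequentially])
  have "(\<lambda>j. fact n * (1 / (real j + \<beta>)) / \<beta> ^ k) \<longlonglongrightarrow> fact n * 0 / \<beta> ^ k"
    using b lim by (intro tendsto_intros) (auto simp: add.commute)
  then have "(\<lambda>j. fact n * (1 / (real j + \<beta>)) / \<beta> ^ k) \<longlonglongrightarrow> 0" by simp
  then show ?thesis
    by (rule Lim_null_comparison[rotated])
      (intro always_eventually allI order.trans[OF norm_connector_le[OF assms(1)] up])
qed

text \<open>
  At the shift \<open>\<beta>\<close> the connector is at most the product of \<open>k / (k + \<beta>)\<close> over \<open>1 \<le> k \<le> n\<close>, and the
  product of \<open>1 + \<beta> / k\<close> exceeds \<open>1 + \<beta> H\<^sub>n\<close>, which is unbounded since the harmonic series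
  diverges. The index is a successor because \<open>n! / (\<alpha>)\<^sub>n\<close> need not tend to \<open>0\<close> when \<open>\<alpha>\<close> is
  small.
\<close>

lemma connector_LIMSEQ_right:
  assumes "minorant \<beta> \<alpha>"
  shows "(\<lambda>n. connector \<alpha> (Suc j) n) \<longlonglongrightarrow> 0"
proof -
  note b = minorant_pos[OF assms(1)]
  have up: "connector \<beta> (Suc j) n \<le> 1 / (1 + \<beta> * harm n)" for n
  proof (induction n)
    case (Suc n)
    have h: "(harm n :: real) \<ge> 0" by (simp add: harm_nonneg)
    have "connector \<beta> (Suc j) (Suc n) \<le>
        1 / (1 + \<beta> * harm n) * (of_nat (Suc n) / (of_nat (Suc n) + \<beta>))"
      unfolding connector_Suc using b Suc h
      by (intro mult_mono divide_left_mono) (auto intro!: divide_nonneg_nonneg mult_pos_pos add_pos_nonneg)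
    also have "\<dots> = 1 / ((1 + \<beta> * harm n) * (1 + \<beta> / real (Suc n)))"
      by (simp add: divide_simps)
    also have "\<dots> \<le> 1 / (1 + \<beta> * harm (Suc n))"
    proof (rule divide_left_mono)
      have "0 \<le> \<beta> * harm n * (\<beta> / real (Suc n))" using b h by simp
      then show "1 + \<beta> * harm (Suc n) \<le> (1 + \<beta> * harm n) * (1 + \<beta> / real (Suc n))"
        by (simp add: harm_Suc algebra_simps divide_inverse)
      show "0 < (1 + \<beta> * harm n) * (1 + \<beta> / real (Suc n)) * (1 + \<beta> * harm (Suc n))"
        using b h harm_nonneg[of "Suc n", where ?'a = real]
        by (intro mult_pos_pos add_pos_nonneg mult_nonneg_nonneg divide_nonneg_nonneg) auto
    qed simp
    finally show ?case .
  qed (simp add: harm_def)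
  have "filterlim (\<lambda>n. 1 + \<beta> * harm n) at_top sequentially"
    using b by (intro filterlim_tendsto_add_at_top[OF tendsto_const]
        filterlim_tendsto_pos_mult_at_top[OF tendsto_const] harm_at_top)
  then have "(\<lambda>n. 1 / (1 + \<beta> * harm n)) \<longlonglongrightarrow> 0"
    by (intro tendsto_divide_0[OF tendsto_const] filterlim_at_top_imp_at_infinity)
  then show ?thesis
    by (rule Lim_null_comparison[rotated])
      (intro always_eventually allI order.trans[OF norm_connector_le[OF assms(1)] up])
qed

text \<open>
  A telescoping series need not converge unconditionally; the nonnegative telescoping majorant \<open>F\<close>
  ensures that it does.
\<close>

lemma has_sum_telescope_dominated:
  fixes f g :: "nat \<Rightarrow> 'a::banach" and F G :: "nat \<Rightarrow> real"
  assumes "\<And>k. f k = g k - g (Suc k)" "g \<longlonglongrightarrow> 0"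
    and "\<And>k. F k = G k - G (Suc k)" "G \<longlonglongrightarrow> 0"
    and "\<And>k. norm (f k) \<le> F k"
  shows "(f has_sum g 0) UNIV"
proof (rule norm_summable_imp_has_sum)
  have "F sums (G 0 - 0)" unfolding assms(3) by (rule telescope_sums'[OF assms(4)])
  then have "summable F" by (rule sums_summable)
  then show "summable (\<lambda>k. norm (f k))"
    by (rule summable_comparison_test'[where N = 0]) (simp add: assms(5))
  show "f sums g 0"
    using telescope_sums'[OF assms(2)] unfolding assms(1) by simp
qed

lemma has_sum_greaterThan:
  assumes "((\<lambda>k. f (Suc (m + k))) has_sum s) UNIV"
  shows "(f has_sum s) {a. m < a}"
proof -
  have "bij_betw (\<lambda>k. Suc (m + k)) UNIV {a. m < a}"
    by (rule bij_betwI[of _ _ _ "\<lambda>a. a - Suc m"]) auto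
  from has_sum_reindex_bij_betw[OF this] assms show ?thesis by blast
qed

lemma connector_sum_left:
  fixes \<alpha> :: "'a::{real_normed_field,banach}"
  assumes "minorant \<beta> \<alpha>" and n: "n > 0"
  shows "((\<lambda>a. wt \<alpha> a * connector \<alpha> a n) has_sum (wt 1 n * connector \<alpha> m n)) {a. m < a}"
proof (rule has_sum_greaterThan)
  have lim: "(\<lambda>k. connector \<gamma> (m + k) n / of_nat n) \<longlonglongrightarrow> 0" if "minorant \<beta> \<gamma>"
    for \<gamma> :: "'b::real_normed_field"
    using tendsto_divide[OF LIMSEQ_ignore_initial_segment[OF connector_LIMSEQ_left[OF that n], of m]
        tendsto_const[of "of_nat n"]] n by (simp add: add.commute)
  note b = minorant_self[OF assms(1)]
  have "((\<lambda>k. wt \<alpha> (Suc (m + k)) * connector \<alpha> (Suc (m + k)) n) has_sum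
      connector \<alpha> (m + 0) n / of_nat n) UNIV"
  proof (rule has_sum_telescope_dominated[where
        F = "\<lambda>k. wt \<beta> (Suc (m + k)) * connector \<beta> (Suc (m + k)) n", OF _ lim[OF assms(1)] _ lim[OF b]])
    show "norm (wt \<alpha> (Suc (m + k)) * connector \<alpha> (Suc (m + k)) n)
        \<le> wt \<beta> (Suc (m + k)) * connector \<beta> (Suc (m + k)) n" for k
      unfolding norm_mult
      by (intro mult_mono norm_wt_le norm_connector_le wt_nonneg assms(1) norm_ge_zero
          minorant_pos[OF assms(1)])
  qed (simp_all only: connector_diff_left[OF assms(1) n] connector_diff_left[OF b n]
      add_Suc_right diff_divide_distrib)
  then show "((\<lambda>k. wt \<alpha> (Suc (m + k)) * connector \<alpha> (Suc (m + k)) n) has_sum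
      wt 1 n * connector \<alpha> m n) UNIV"
    by (simp add: wt_one)
qed

lemma connector_sum_right:
  fixes \<alpha> :: "'a::{real_normed_field,banach}"
  assumes "minorant \<beta> \<alpha>" and m: "m > 0"
  shows "((\<lambda>b. wt 1 b * connector \<alpha> m b) has_sum (wt \<alpha> m * connector \<alpha> m n)) {b. n < b}"
proof (rule has_sum_greaterThan)
  obtain j where j: "m = Suc j" using m by (cases m) auto
  have lim: "(\<lambda>k. connector \<gamma> m (n + k) / (of_nat j + \<gamma>)) \<longlonglongrightarrow> 0" if "minorant \<beta> \<gamma>"
    for \<gamma> :: "'b::real_normed_field"
    using tendsto_divide[OF LIMSEQ_ignore_initial_segment[OF connector_LIMSEQ_right[OF that], of j n]
        tendsto_const[of "of_nat j + \<gamma>"]] minorant_nonzero[OF that, of j] by (simp add: add.commute j)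
  note b = minorant_self[OF assms(1)]
  have "((\<lambda>k. wt 1 (Suc (n + k)) * connector \<alpha> m (Suc (n + k))) has_sum
      connector \<alpha> m (n + 0) / (of_nat j + \<alpha>)) UNIV"
  proof (rule has_sum_telescope_dominated[where
        F = "\<lambda>k. wt 1 (Suc (n + k)) * connector \<beta> m (Suc (n + k))", OF _ lim[OF assms(1)] _ lim[OF b]])
    show "norm (wt 1 (Suc (n + k)) * connector \<alpha> m (Suc (n + k)))
        \<le> wt 1 (Suc (n + k)) * connector \<beta> m (Suc (n + k))" for k
      unfolding norm_mult wt_one norm_divide norm_one norm_of_nat
      by (intro mult_left_mono norm_connector_le assms(1)) simp
  qed (simp_all only: connector_diff_right[OF assms(1)] connector_diff_right[OF b] j
      add_Suc_right diff_divide_distrib)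
  then show "((\<lambda>k. wt 1 (Suc (n + k)) * connector \<alpha> m (Suc (n + k))) has_sum
      wt \<alpha> m * connector \<alpha> m n) UNIV"
    by (simp add: j)
qed

text \<open>
  The heart of the proof. For \<open>x\<^sub>1\<close> one side is a telescoping sum over \<open>a > m\<close> and the other the
  single term at \<open>n\<close>; for \<open>x\<^sub>-\<^sub>1\<close> the roles are exchanged. For \<open>x\<^sub>0\<close> both sums contain their
  first terms, and the equality is the sum of the two previous ones. The side conditions exclude the
  starting point \<open>0\<close>, except where a path begins: with \<open>x\<^sub>1\<close> on either side.
\<close>

lemma connector_transport:
  fixes \<alpha> :: "'a::{real_normed_field,banach}"
  assumes "minorant \<beta> \<alpha>" and m: "m = 0 \<Longrightarrow> e = X1" and n: "n = 0 \<Longrightarrow> e = Xm1"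
  obtains D where "((\<lambda>a. wt \<alpha> a * connector \<alpha> a n) has_sum D) {a. step e m a}"
    and "((\<lambda>b. wt 1 b * connector \<alpha> m b) has_sum D) {b. step (opp e) n b}"
proof -
  have single: "(f has_sum f x) {a. x = a}" for f :: "nat \<Rightarrow> 'a" and x
    using has_sum_finite[of "{x}" f] by (simp add: eq_commute)
  have le: "{a. x \<le> a} = {a. x = a} \<union> {a. x < a}" for x :: nat by auto
  show ?thesis
  proof (cases e)
    case X1
    with n have "n > 0" by (cases n) auto
    with X1 show ?thesis
      using connector_sum_left[OF assms(1), of n m] single[of "\<lambda>b. wt 1 b * connector \<alpha> m b" n]
      by (intro that) simp_all
  next
    case Xm1
    with m have "m > 0" by (cases m) auto
    with Xm1 show ?thesis
      using connector_sum_right[OF assms(1), of m n] single[of "\<lambda>a. wt \<alpha> a * connector \<alpha> a n" m]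
      by (intro that) simp_all
  next
    case X0
    with m n have "m > 0" "n > 0" by (cases m; cases n; auto)+
    note L = has_sum_Un_disjoint[OF single[of "\<lambda>a. wt \<alpha> a * connector \<alpha> a n" m]
        connector_sum_left[OF assms(1) \<open>n > 0\<close>, of m], folded le]
    note R = has_sum_Un_disjoint[OF single[of "\<lambda>b. wt 1 b * connector \<alpha> m b" n]
        connector_sum_right[OF assms(1) \<open>m > 0\<close>, of n], folded le]
    show ?thesis
      by (rule that) (use L R X0 in \<open>simp_all add: add.commute disjoint_iff\<close>)
  qed
qed

section \<open>Connected sums\<close>

lemma summable_on_norm_le:
  fixes f :: "'i \<Rightarrow> 'a::banach"
  assumes "g summable_on A" "\<And>x. x \<in> A \<Longrightarrow> norm (f x) \<le> g x"
  shows "f summable_on A"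
  by (rule abs_summable_summable, rule Infinite_Sum.abs_summable_on_comparison_test'[OF assms])

lemma has_sum_exchange:
  "((\<lambda>(p, a). F (fst p) (snd p) a) has_sum s) (SIGMA p:UNIV. {a. R (fst p) a}) \<longleftrightarrow>
   ((\<lambda>(q, m). F m (snd q) (fst q)) has_sum s) (SIGMA q:UNIV. {m. R m (fst q)})"
  by (rule has_sum_reindex_bij_witness[where
      i = "\<lambda>(q, m). ((m, snd q), fst q)" and j = "\<lambda>(p, a). ((a, snd p), fst p)"]) auto

text \<open>
  Fubini for a triple sum over \<open>(m, n, a)\<close> with \<open>R m a\<close>. The index \<open>n\<close> is a spectator: it is paired
  with \<open>m\<close> in one iterated sum and with \<open>a\<close> in the other.
\<close>

lemma has_sum_exchange_dominated:
  fixes F :: "'m \<Rightarrow> 'n \<Rightarrow> 'a \<Rightarrow> 'b::banach" and G :: "'m \<Rightarrow> 'n \<Rightarrow> 'a \<Rightarrow> real"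
  assumes dom: "\<And>m n a. norm (F m n a) \<le> G m n a"
    and F1: "\<And>m n. ((\<lambda>a. F m n a) has_sum f1 m n) {a. R m a}"
    and G1: "\<And>m n. ((\<lambda>a. G m n a) has_sum g1 m n) {a. R m a}"
    and F2: "\<And>a n. ((\<lambda>m. F m n a) has_sum f2 a n) {m. R m a}"
    and G2: "\<And>a n. ((\<lambda>m. G m n a) has_sum g2 a n) {m. R m a}"
    and g1: "(\<lambda>(m, n). g1 m n) summable_on UNIV"
    and f1: "((\<lambda>(m, n). f1 m n) has_sum s) UNIV"
  shows "(\<lambda>(a, n). g2 a n) summable_on UNIV \<and> ((\<lambda>(a, n). f2 a n) has_sum s) UNIV"
proof -
  define S T where "S = (SIGMA p:(UNIV :: ('m \<times> 'n) set). {a. R (fst p) a})"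
    and "T = (SIGMA q:(UNIV :: ('a \<times> 'n) set). {m. R m (fst q)})"
  have nonneg: "G m n a \<ge> 0" for m n a using order.trans[OF norm_ge_zero dom] .
  have GS: "(\<lambda>(p, a). G (fst p) (snd p) a) summable_on S" unfolding S_def
    by (rule summable_on_SigmaI[where g = "\<lambda>p. g1 (fst p) (snd p)"])
      (use G1 g1 nonneg in \<open>auto simp: case_prod_unfold\<close>)
  then obtain t where t: "((\<lambda>(p, a). G (fst p) (snd p) a) has_sum t) S"
    by (auto simp: summable_on_def)
  have "((\<lambda>(q, m). G m (snd q) (fst q)) has_sum t) T"
    using t unfolding S_def T_def by (subst (asm) has_sum_exchange)
  then have "((\<lambda>q. g2 (fst q) (snd q)) has_sum t) UNIV" unfolding T_def
    by (rule has_sum_SigmaD) (use G2 in auto)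
  moreover have FS: "(\<lambda>(p, a). F (fst p) (snd p) a) summable_on S"
    by (rule summable_on_norm_le[OF GS]) (auto intro: dom)
  have "((\<lambda>(p, a). F (fst p) (snd p) a) has_sum s) S" unfolding S_def
    by (rule has_sum_SigmaI[where g = "\<lambda>p. f1 (fst p) (snd p)"])
      (use F1 f1 FS in \<open>auto simp: case_prod_unfold S_def\<close>)
  then have "((\<lambda>(q, m). F m (snd q) (fst q)) has_sum s) T"
    unfolding S_def T_def by (subst (asm) has_sum_exchange)
  then have "((\<lambda>q. f2 (fst q) (snd q)) has_sum s) UNIV" unfolding T_def
    by (rule has_sum_SigmaD) (use F2 in auto)
  ultimately show ?thesis by (auto simp: summable_on_def case_prod_unfold)
qed

definition connected_sum_term :: "'a::real_normed_field \<Rightarrow> letter list \<Rightarrow> letter list \<Rightarrow> nat \<times> nat \<Rightarrow> 'a" where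
  "connected_sum_term \<alpha> u u' = (\<lambda>(m, n). path_sum \<alpha> u m * path_sum 1 u' n * connector \<alpha> m n)"

lemma path_sum_one_nonneg: "path_sum 1 w n \<ge> (0 :: real)"
  by (rule path_sum_nonneg) simp

lemma norm_path_sum_one_le:
  "norm (path_sum 1 w n :: 'a::real_normed_field) \<le> path_sum 1 w n"
  by (rule norm_path_sum_le[OF minorant_one])

text \<open>
  Both sides equal the double sum of \<open>path_sum \<alpha> u m * path_sum 1 u' n * D m n\<close>, where \<open>D m n\<close> is
  the common value in \<open>connector_transport\<close>. Where that lemma is not applicable, one of the first two
  factors vanishes.
\<close>

lemma connected_sum_transport:
  fixes \<alpha> :: "'a::{real_normed_field,banach}"
  assumes "minorant \<beta> \<alpha>" and u: "u = [] \<Longrightarrow> e = X1" and u': "u' = [] \<Longrightarrow> e = Xm1"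
    and summ: "connected_sum_term \<beta> (u @ [e]) u' summable_on UNIV"
    and sum: "(connected_sum_term \<alpha> (u @ [e]) u' has_sum s) UNIV"
  shows "connected_sum_term \<beta> u (u' @ [opp e]) summable_on UNIV \<and>
    (connected_sum_term \<alpha> u (u' @ [opp e]) has_sum s) UNIV"
proof -
  note b = minorant_self[OF assms(1)] and pos = minorant_pos[OF assms(1)]
  have "\<exists>D. (path_sum \<gamma> u m * path_sum 1 u' n \<noteq> 0 \<longrightarrow>
      ((\<lambda>a. wt \<gamma> a * connector \<gamma> a n) has_sum D) {a. step e m a} \<and>
      ((\<lambda>b. wt 1 b * connector \<gamma> m b) has_sum D) {b. step (opp e) n b})"
    if "minorant \<beta> \<gamma>" for \<gamma> :: "'b::{real_normed_field,banach}" and m n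
  proof (cases "path_sum \<gamma> u m * path_sum 1 u' n = 0")
    case False
    have m: "e = X1" if "m = 0"
      using False u path_sum_0[of u \<gamma>] that by (cases "u = []") auto
    have n: "e = Xm1" if "n = 0"
      using False u' path_sum_0[of u' "1 :: 'b"] that by (cases "u' = []") auto
    show ?thesis
      by (rule connector_transport[OF that m n]) blast+
  qed simp
  note ex = this
  obtain Da where Da: "\<And>m n. path_sum \<alpha> u m * path_sum 1 u' n \<noteq> 0 \<Longrightarrow>
      ((\<lambda>a. wt \<alpha> a * connector \<alpha> a n) has_sum Da m n) {a. step e m a} \<and>
      ((\<lambda>b. wt 1 b * connector \<alpha> m b) has_sum Da m n) {b. step (opp e) n b}"
  proof -
    have "\<forall>m n. \<exists>D. path_sum \<alpha> u m * path_sum 1 u' n \<noteq> 0 \<longrightarrow>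
      ((\<lambda>a. wt \<alpha> a * connector \<alpha> a n) has_sum D) {a. step e m a} \<and>
      ((\<lambda>b. wt 1 b * connector \<alpha> m b) has_sum D) {b. step (opp e) n b}"
      using ex[OF assms(1)] by blast
    from this[unfolded choice_iff] show ?thesis using that by blast
  qed
  obtain Db where Db: "\<And>m n. path_sum \<beta> u m * path_sum 1 u' n \<noteq> 0 \<Longrightarrow>
      ((\<lambda>a. wt \<beta> a * connector \<beta> a n) has_sum Db m n) {a. step e m a} \<and>
      ((\<lambda>b. wt 1 b * connector \<beta> m b) has_sum Db m n) {b. step (opp e) n b}"
  proof -
    have "\<forall>m n. \<exists>D. path_sum \<beta> u m * path_sum 1 u' n \<noteq> 0 \<longrightarrow>
      ((\<lambda>a. wt \<beta> a * connector \<beta> a n) has_sum D) {a. step e m a} \<and>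
      ((\<lambda>b. wt 1 b * connector \<beta> m b) has_sum D) {b. step (opp e) n b}"
      using ex[OF b] by blast
    from this[unfolded choice_iff] show ?thesis using that by blast
  qed
  have cm: "((\<lambda>x. A * f x) has_sum A * D) S" if "A \<noteq> 0 \<Longrightarrow> (f has_sum D) S"
    for A D :: "'c::real_normed_field" and f :: "nat \<Rightarrow> 'c" and S
    using that has_sum_cmult_right[of f S D A] by (cases "A = 0") auto
  have dom1: "norm (path_sum \<alpha> u m * path_sum 1 u' n * (wt \<alpha> a * connector \<alpha> a n))
      \<le> path_sum \<beta> u m * path_sum 1 u' n * (wt \<beta> a * connector \<beta> a n)" for m n a
    unfolding norm_mult
    by (intro mult_mono norm_path_sum_le norm_path_sum_one_le norm_wt_le norm_connector_le assms(1)
        mult_nonneg_nonneg path_sum_nonneg pos wt_nonneg connector_nonneg norm_ge_zero path_sum_one_nonneg)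
  have dom2: "norm (path_sum \<alpha> u m * path_sum 1 u' n * (wt 1 a * connector \<alpha> m a))
      \<le> path_sum \<beta> u m * path_sum 1 u' n * (wt 1 a * connector \<beta> m a)" for m n a
    unfolding norm_mult wt_one norm_divide norm_one norm_of_nat
    by (intro mult_mono norm_path_sum_le norm_path_sum_one_le norm_connector_le assms(1) order.refl
        mult_nonneg_nonneg path_sum_nonneg pos connector_nonneg norm_ge_zero path_sum_one_nonneg) auto
  have fin1: "((\<lambda>m. path_sum \<gamma> u m * path_sum 1 u' n * (wt \<gamma> a * connector \<gamma> a n)) has_sum
      connected_sum_term \<gamma> (u @ [e]) u' (a, n)) {m. step e m a}" for \<gamma> :: "'c::real_normed_field" and a n
    using has_sum_finite[OF finite_step, of "\<lambda>m. path_sum \<gamma> u m * path_sum 1 u' n * (wt \<gamma> a * connector \<gamma> a n)" e a]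
    by (simp add: connected_sum_term_def path_sum_snoc sum_distrib_left sum_distrib_right mult_ac)
  have fin2: "((\<lambda>n. path_sum \<gamma> u m * path_sum 1 u' n * (wt 1 a * connector \<gamma> m a)) has_sum
      connected_sum_term \<gamma> u (u' @ [opp e]) (m, a)) {n. step (opp e) n a}" for \<gamma> :: "'c::real_normed_field" and a m
    using has_sum_finite[OF finite_step, of "\<lambda>n. path_sum \<gamma> u m * path_sum 1 u' n * (wt 1 a * connector \<gamma> m a)" "opp e" a]
    by (simp add: connected_sum_term_def path_sum_snoc sum_distrib_left sum_distrib_right mult_ac)
  have left_a: "((\<lambda>a. path_sum \<alpha> u m * path_sum 1 u' n * (wt \<alpha> a * connector \<alpha> a n)) has_sum
      path_sum \<alpha> u m * path_sum 1 u' n * Da m n) {a. step e m a}" for m n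
    by (rule cm, rule conjunct1, rule Da)
  have right_a: "((\<lambda>b. path_sum \<alpha> u m * path_sum 1 u' n * (wt 1 b * connector \<alpha> m b)) has_sum
      path_sum \<alpha> u m * path_sum 1 u' n * Da m n) {b. step (opp e) n b}" for m n
    by (rule cm, rule conjunct2, rule Da)
  have left_b: "((\<lambda>a. path_sum \<beta> u m * path_sum 1 u' n * (wt \<beta> a * connector \<beta> a n)) has_sum
      path_sum \<beta> u m * path_sum 1 u' n * Db m n) {a. step e m a}" for m n
    by (rule cm, rule conjunct1, rule Db)
  have right_b: "((\<lambda>b. path_sum \<beta> u m * path_sum 1 u' n * (wt 1 b * connector \<beta> m b)) has_sum
      path_sum \<beta> u m * path_sum 1 u' n * Db m n) {b. step (opp e) n b}" for m n
    by (rule cm, rule conjunct2, rule Db)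
  have 1: "(\<lambda>(m, n). path_sum \<beta> u m * path_sum 1 u' n * Db m n) summable_on UNIV \<and>
    ((\<lambda>(m, n). path_sum \<alpha> u m * path_sum 1 u' n * Da m n) has_sum s) UNIV"
    using has_sum_exchange_dominated[where R = "\<lambda>a m. step e m a"
        and F = "\<lambda>a n m. path_sum \<alpha> u m * path_sum 1 u' n * (wt \<alpha> a * connector \<alpha> a n)"
        and G = "\<lambda>a n m. path_sum \<beta> u m * path_sum 1 u' n * (wt \<beta> a * connector \<beta> a n)",
        OF dom1 fin1 fin1 left_a left_b] summ sum by simp
  have 2: "(\<lambda>(n, m). path_sum \<beta> u m * path_sum 1 u' n * Db m n) summable_on UNIV"
    using conjunct1[OF 1] summable_on_swap[where f = "\<lambda>(m, n). path_sum \<beta> u m * path_sum 1 u' n * Db m n" and A = UNIV and B = UNIV]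
    by simp
  have 3: "((\<lambda>(n, m). path_sum \<alpha> u m * path_sum 1 u' n * Da m n) has_sum s) UNIV"
    using conjunct2[OF 1] has_sum_swap[where f = "\<lambda>(m, n). path_sum \<alpha> u m * path_sum 1 u' n * Da m n" and S = s and A = UNIV and B = UNIV]
    by simp
  have "(\<lambda>(b, m). connected_sum_term \<beta> u (u' @ [opp e]) (m, b)) summable_on UNIV \<and>
    ((\<lambda>(b, m). connected_sum_term \<alpha> u (u' @ [opp e]) (m, b)) has_sum s) UNIV"
    by (rule has_sum_exchange_dominated[where R = "\<lambda>n b. step (opp e) n b"
        and F = "\<lambda>n m b. path_sum \<alpha> u m * path_sum 1 u' n * (wt 1 b * connector \<alpha> m b)"
        and G = "\<lambda>n m b. path_sum \<beta> u m * path_sum 1 u' n * (wt 1 b * connector \<beta> m b)",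
        OF dom2 right_a right_b fin2 fin2 2 3])
  then show ?thesis
    using has_sum_swap[where f = "connected_sum_term \<alpha> u (u' @ [opp e])" and S = s and A = UNIV and B = UNIV]
      summable_on_swap[where f = "connected_sum_term \<beta> u (u' @ [opp e])" and A = UNIV and B = UNIV] by simp
qed

lemma connected_sum_transport_word:
  fixes \<alpha> :: "'a::{real_normed_field,banach}"
  assumes "minorant \<beta> \<alpha>" and "w = X1 # es @ [Xm1]"
    and summ: "connected_sum_term \<beta> w [] summable_on UNIV"
    and sum: "(connected_sum_term \<alpha> w [] has_sum s) UNIV"
  shows "connected_sum_term \<beta> [] (rev (map opp w)) summable_on UNIV \<and>
    (connected_sum_term \<alpha> [] (rev (map opp w)) has_sum s) UNIV"
proof -
  have "w = u @ v \<Longrightarrow> connected_sum_term \<beta> u (rev (map opp v)) summable_on UNIV \<and>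
    (connected_sum_term \<alpha> u (rev (map opp v)) has_sum s) UNIV" for u v
  proof (induction v arbitrary: u)
    case (Cons e v)
    have "w = (u @ [e]) @ v" using Cons.prems by simp
    note IH = Cons.IH[OF this]
    have "u = [] \<Longrightarrow> e = X1" using Cons.prems assms(2) by simp
    moreover have "v = [] \<Longrightarrow> e = Xm1" using Cons.prems assms(2)
      by (metis append_Cons last_snoc)
    ultimately show ?case
      using connected_sum_transport[OF assms(1) _ _ conjunct1[OF IH] conjunct2[OF IH]] by simp
  qed (use summ sum in simp)
  from this[of "[]" w] show ?thesis by simp
qed

lemma connected_sum_term_Nil_right:
  "(connected_sum_term \<alpha> w [] has_sum s) UNIV \<longleftrightarrow> (path_sum \<alpha> w has_sum s) UNIV"
proof -
  have "(connected_sum_term \<alpha> w [] has_sum s) UNIV \<longleftrightarrow>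
      (connected_sum_term \<alpha> w [] has_sum s) ((\<lambda>m. (m, 0)) ` UNIV)"
    by (rule has_sum_cong_neutral) (auto simp: connected_sum_term_def)
  also have "\<dots> \<longleftrightarrow> (path_sum \<alpha> w has_sum s) UNIV"
    by (subst has_sum_reindex) (auto simp: inj_on_def connected_sum_term_def o_def)
  finally show ?thesis .
qed

lemma connected_sum_term_Nil_left:
  "(connected_sum_term \<alpha> [] w has_sum s) UNIV \<longleftrightarrow>
   ((\<lambda>n. path_sum 1 w n * connector \<alpha> 0 n) has_sum s) UNIV"
proof -
  have "(connected_sum_term \<alpha> [] w has_sum s) UNIV \<longleftrightarrow>
      (connected_sum_term \<alpha> [] w has_sum s) ((\<lambda>n. (0, n)) ` UNIV)"
    by (rule has_sum_cong_neutral) (auto simp: connected_sum_term_def)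
  also have "\<dots> \<longleftrightarrow> ((\<lambda>n. path_sum 1 w n * connector \<alpha> 0 n) has_sum s) UNIV"
    by (subst has_sum_reindex) (auto simp: inj_on_def connected_sum_term_def o_def)
  finally show ?thesis .
qed

section \<open>Convergence of the path sums\<close>

lemma wt_le:
  assumes "\<beta> > 0" shows "wt \<beta> a \<le> (1 + 2 / \<beta>) / (real a + 1)"
proof (cases a)
  case (Suc j)
  have "real j + 2 \<le> (1 + 2 / \<beta>) * (real j + \<beta>)"
    using assms by (simp add: field_simps)
  then show ?thesis using assms by (simp add: Suc divide_simps add_nonneg_pos mult.commute add.commute)
qed (use assms in simp)

text \<open>
  The weight \<open>1 / (a + 1)\<close> is reproduced up to a constant by each summation, because
  \<open>1 / (a + 1)\<^sup>2\<close> is dominated by a multiple of \<open>1 / (a + 1) - 1 / (a + 2)\<close>. This is what makes the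
  induction on the word in \<open>summable_path_sum_weighted\<close> work.
\<close>

lemma tail_sum_bound:
  assumes "\<beta> > 0"
  obtains D where "\<And>m. ((\<lambda>a. wt \<beta> a * (1 / (real a + 1))) has_sum D m) {a. step e m a}"
    and "\<And>m. D m \<le> (1 + 2 / \<beta>) * 2 / (real m + 1)"
proof -
  define K where "K = 1 + 2 / \<beta>"
  have K: "K > 0" using assms by (simp add: K_def add_pos_pos)
  define f where "f = (\<lambda>a. wt \<beta> a * (1 / (real a + 1)))"
  have f0: "f a \<ge> 0" for a using wt_nonneg[OF assms, of a] by (simp add: f_def)
  have bound: "f a \<le> K * 2 / (real a + 1) - K * 2 / (real (Suc a) + 1)" for a
  proof -
    have "f a \<le> K / (real a + 1) * (1 / (real a + 1))"
      unfolding f_def K_def by (intro mult_right_mono wt_le assms) simp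
    also have "\<dots> = K * (1 / ((real a + 1) * (real a + 1)))" by simp
    \<comment> \<open>since \<open>a + 2 \<le> 2 (a + 1)\<close>\<close>
    also have "\<dots> \<le> K * (2 / ((real a + 1) * (real a + 2)))"
      using K by (intro mult_left_mono) (auto simp: divide_simps)
    also have "\<dots> = K * 2 / (real a + 1) - K * 2 / (real (Suc a) + 1)"
      by (simp add: divide_simps) (simp add: algebra_simps)
    finally show ?thesis .
  qed
  have fin: "sum f F \<le> K * 2 / (real m + 1)" if finF: "finite F" and F: "F \<subseteq> {a. step e m a}" for F m
  proof -
    obtain N where N: "F \<subseteq> {..<N}" using finF finite_nat_iff_bounded[of F] by blast
    have sub: "F \<subseteq> {m..<max m N}"
    proof
      fix x assume "x \<in> F"
      then have "step e m x" "x < N" using F N by auto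
      then show "x \<in> {m..<max m N}" by (cases e) auto
    qed
    have "sum f F \<le> (\<Sum>a\<in>{m..<max m N}. K * 2 / (real a + 1) - K * 2 / (real (Suc a) + 1))"
      by (rule order.trans[OF sum_mono2[OF _ sub] sum_mono[OF bound]]) (auto intro: f0)
    also have "\<dots> = K * 2 / (real m + 1) - K * 2 / (real (max m N) + 1)"
      using sum_Suc_diff'[of m "max m N" "\<lambda>a. - (K * 2 / (real a + 1))"] by (simp add: algebra_simps)
    also have "\<dots> \<le> K * 2 / (real m + 1)" using K by simp
    finally show ?thesis .
  qed
  have summ: "f summable_on {a. step e m a}" for m
    by (rule nonneg_bdd_above_summable_on) (auto simp: f0 intro!: bdd_aboveI2 fin)
  show ?thesis
  proof (rule that)
    show "((\<lambda>a. wt \<beta> a * (1 / (real a + 1))) has_sum infsum f {a. step e m a}) {a. step e m a}" for m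
      using summ[of m] unfolding f_def by (rule has_sum_infsum)
    show "infsum f {a. step e m a} \<le> (1 + 2 / \<beta>) * 2 / (real m + 1)" for m
      unfolding K_def[symmetric] by (rule infsum_le_finite_sums[OF summ]) (use fin in auto)
  qed
qed

lemma summable_path_sum_weighted:
  assumes "\<beta> > 0"
  shows "(\<lambda>m. path_sum \<beta> w m * (1 / (real m + 1))) summable_on UNIV"
proof (induction w rule: rev_induct)
  case Nil
  show ?case
    by (rule summable_on_cong_neutral[THEN iffD2, OF _ _ _ summable_on_finite[of "{0}"]]) auto
next
  case (snoc e w)
  obtain D where D: "\<And>m. ((\<lambda>a. wt \<beta> a * (1 / (real a + 1))) has_sum D m) {a. step e m a}"
    and bd: "\<And>m. D m \<le> (1 + 2 / \<beta>) * 2 / (real m + 1)"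
    by (rule tail_sum_bound[OF assms, of e]) blast
  have D0: "D m \<ge> 0" for m
    by (rule has_sum_nonneg[OF D]) (auto intro!: divide_nonneg_nonneg wt_nonneg assms)
  have out: "(\<lambda>m. path_sum \<beta> w m * D m) summable_on UNIV"
  proof (rule summable_on_comparison_test)
    show "(\<lambda>m. (1 + 2 / \<beta>) * 2 * (path_sum \<beta> w m * (1 / (real m + 1)))) summable_on UNIV"
      by (rule summable_on_cmult_right[OF snoc])
    show "path_sum \<beta> w m * D m \<le> (1 + 2 / \<beta>) * 2 * (path_sum \<beta> w m * (1 / (real m + 1)))" for m
      using mult_left_mono[OF bd path_sum_nonneg[OF assms]] by (simp add: mult_ac)
  qed (intro mult_nonneg_nonneg D0 path_sum_nonneg assms)
  let ?F = "\<lambda>m (_ :: unit) a. path_sum \<beta> w m * (wt \<beta> a * (1 / (real a + 1)))"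
  have reunit: "(\<lambda>(m, _ :: unit). h m) summable_on UNIV \<longleftrightarrow> h summable_on UNIV" for h :: "nat \<Rightarrow> real"
    using summable_on_reindex_bij_betw[of "\<lambda>m :: nat. (m, ())" UNIV UNIV "\<lambda>(m, _ :: unit). h m"]
    by (simp add: bij_betw_def inj_on_def surj_def)
  have "(\<lambda>(a, n). (\<Sum>m | step e m a. ?F m n a)) summable_on UNIV \<and>
      ((\<lambda>(a, n). (\<Sum>m | step e m a. ?F m n a)) has_sum
        infsum (\<lambda>(m, n :: unit). path_sum \<beta> w m * D m) UNIV) UNIV"
  proof (rule has_sum_exchange_dominated[where F = ?F and R = "step e" and G = ?F])
    show "norm (?F m n a) \<le> ?F m n a" for m n a
      using path_sum_nonneg[OF assms, of w m] wt_nonneg[OF assms, of a] by simp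
    show "(\<lambda>(m, n :: unit). path_sum \<beta> w m * D m) summable_on UNIV"
      using out by (simp add: reunit)
    then show "((\<lambda>(m, n :: unit). path_sum \<beta> w m * D m) has_sum
        infsum (\<lambda>(m, n :: unit). path_sum \<beta> w m * D m) UNIV) UNIV"
      by (rule has_sum_infsum)
  qed (rule has_sum_cmult_right[OF D] has_sum_finite[OF finite_step])+
  then have "(\<lambda>a. \<Sum>m | step e m a. path_sum \<beta> w m * (wt \<beta> a * (1 / (real a + 1)))) summable_on UNIV"
    by (simp add: reunit)
  then show ?case by (simp add: path_sum_snoc sum_distrib_left sum_distrib_right mult_ac)
qed

text \<open>
  The final letter \<open>x\<^sub>-\<^sub>1\<close>, which expresses that the last exponent is at least \<open>2\<close>, supplies the
  weight of the previous lemma.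
\<close>

lemma summable_path_sum:
  assumes "(\<beta> :: real) > 0" shows "path_sum \<beta> (w @ [Xm1]) summable_on UNIV"
proof (rule summable_on_comparison_test)
  show "(\<lambda>m. (1 + 2 / \<beta>) * (path_sum \<beta> w m * (1 / (real m + 1)))) summable_on UNIV"
    by (rule summable_on_cmult_right[OF summable_path_sum_weighted[OF assms]])
  show "path_sum \<beta> (w @ [Xm1]) m \<le> (1 + 2 / \<beta>) * (path_sum \<beta> w m * (1 / (real m + 1)))" for m
    using mult_right_mono[OF wt_le[OF assms, of m] path_sum_nonneg[OF assms, of w m]]
    by (simp add: path_sum_snoc mult_ac)
qed (rule path_sum_nonneg[OF assms])

text \<open>
  The case \<open>r = 0\<close> in the language of letters. Since \<open>connector \<alpha> m 0 = 1\<close>, the connected sum with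
  empty second word is the Hurwitz series of \<open>w\<close>; with empty first word only \<open>m = 0\<close> contributes.
\<close>

lemma path_sum_duality:
  fixes \<alpha> :: "'a::{real_normed_field,banach}"
  assumes "minorant \<beta> \<alpha>" and w: "w = X1 # es @ [Xm1]"
  shows "path_sum \<beta> w summable_on UNIV"
    and "(\<lambda>n. path_sum 1 (rev (map opp w)) n * connector \<beta> 0 n) summable_on UNIV"
    and "\<exists>s. (path_sum \<alpha> w has_sum s) UNIV \<and>
      ((\<lambda>n. path_sum 1 (rev (map opp w)) n * connector \<alpha> 0 n) has_sum s) UNIV"
proof -
  show 1: "path_sum \<beta> w summable_on UNIV"
    using summable_path_sum[OF minorant_pos[OF assms(1)], of "X1 # es"] by (simp add: w)
  then have summ: "connected_sum_term \<beta> w [] summable_on UNIV"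
    by (simp add: summable_on_def connected_sum_term_Nil_right)
  have "path_sum \<alpha> w summable_on UNIV"
    by (rule summable_on_norm_le[OF 1]) (rule norm_path_sum_le[OF assms(1)])
  then obtain s where s: "(path_sum \<alpha> w has_sum s) UNIV"
    by (auto simp: summable_on_def)
  have "(connected_sum_term \<alpha> w [] has_sum s) UNIV"
    using s by (simp add: connected_sum_term_Nil_right)
  note * = connected_sum_transport_word[OF assms(1) w summ this]
  then show "\<exists>s. (path_sum \<alpha> w has_sum s) UNIV \<and>
      ((\<lambda>n. path_sum 1 (rev (map opp w)) n * connector \<alpha> 0 n) has_sum s) UNIV"
    using s unfolding connected_sum_term_Nil_left by blast
  show "(\<lambda>n. path_sum 1 (rev (map opp w)) n * connector \<beta> 0 n) summable_on UNIV"
    using * by (simp add: summable_on_def connected_sum_term_Nil_left)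
qed

section \<open>Chains indexed by blocks\<close>

definition chains :: "(bool \<times> nat) list \<Rightarrow> nat list set" where
  "chains b = {m. length m = length b \<and>
     (\<forall>i. Suc i < length b \<longrightarrow> lt (fst (b ! Suc i)) (m ! i) (m ! Suc i))}"

definition chain_prod :: "(nat \<Rightarrow> 'a::comm_monoid_mult) \<Rightarrow> (bool \<times> nat) list \<Rightarrow> nat list \<Rightarrow> 'a" where
  "chain_prod y b m = (\<Prod>i<length b. y (m ! i) ^ snd (b ! i))"

abbreviation chains_to :: "(bool \<times> nat) list \<Rightarrow> nat \<Rightarrow> nat list set" where
  "chains_to b a \<equiv> {m \<in> chains b. last m = a}"

lemma chains_singleton: "chains [x] = {[a] |a. True}"
  by (auto simp: chains_def length_Suc_conv)

lemma chains_snoc: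
  assumes "b \<noteq> []"
  shows "chains (b @ [(c, k)]) = {m @ [a] |m a. m \<in> chains b \<and> lt c (last m) a}"
proof (rule set_eqI, rule iffI)
  fix m assume m: "m \<in> chains (b @ [(c, k)])"
  then obtain m' a where ma: "m = m' @ [a]"
    by (cases m rule: rev_cases) (auto simp: chains_def)
  have len: "length m' = length b" using m by (simp add: chains_def ma)
  have *: "lt (fst ((b @ [(c, k)]) ! Suc i)) (m ! i) (m ! Suc i)" if "Suc i < Suc (length b)" for i
    using m that by (simp add: chains_def)
  have "m' \<in> chains b" unfolding chains_def
  proof (intro CollectI conjI allI impI len)
    fix i assume "Suc i < length b"
    then show "lt (fst (b ! Suc i)) (m' ! i) (m' ! Suc i)"
      using *[of i] len by (simp add: ma nth_append)
  qed
  moreover have "lt c (last m') a"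
  proof -
    have "Suc (length b - 1) = length b" using assms by (cases b) auto
    moreover have "m' \<noteq> []" using len assms by auto
    ultimately show ?thesis using *[of "length b - 1"] len assms
      by (auto simp: ma nth_append last_conv_nth)
  qed
  ultimately show "m \<in> {m @ [a] |m a. m \<in> chains b \<and> lt c (last m) a}" using ma by blast
next
  fix m assume "m \<in> {m @ [a] |m a. m \<in> chains b \<and> lt c (last m) a}"
  then obtain m' a where ma: "m = m' @ [a]" and m': "m' \<in> chains b" "lt c (last m') a" by blast
  have len: "length m' = length b" using m' by (simp add: chains_def)
  show "m \<in> chains (b @ [(c, k)])" unfolding chains_def
  proof (intro CollectI conjI allI impI)
    fix i assume i: "Suc i < length (b @ [(c, k)])"
    show "lt (fst ((b @ [(c, k)]) ! Suc i)) (m ! i) (m ! Suc i)"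
    proof (cases "Suc i < length b")
      case True
      then show ?thesis using m'(1) len by (simp add: chains_def ma nth_append)
    next
      case False
      then have "Suc i = length b" using i by simp
      moreover from this have "i = length b - 1" by simp
      moreover have "m' \<noteq> []" using len assms by auto
      ultimately show ?thesis using m'(2) len assms
        by (auto simp: ma nth_append last_conv_nth)
    qed
  qed (simp add: ma len)
qed

lemma chains_to_snoc:
  assumes "b \<noteq> []"
  shows "chains_to (b @ [(c, k)]) a = (\<lambda>m. m @ [a]) ` (\<Union>m'\<in>{m'. lt c m' a}. chains_to b m')"
  unfolding chains_snoc[OF assms] by auto

lemma chain_prod_snoc:
  assumes "length m = length b"
  shows "chain_prod y (b @ [(c, k)]) (m @ [a]) = chain_prod y b m * y a ^ k"
  using assms by (simp add: chain_prod_def nth_append lessThan_Suc mult.commute)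

lemma norm_chain_prod_le:
  assumes "minorant \<beta> \<alpha>"
  shows "norm (chain_prod (\<lambda>m. 1 / (of_nat m + \<alpha>)) b m) \<le> chain_prod (\<lambda>m. 1 / (real m + \<beta>)) b m"
  unfolding chain_prod_def prod_norm[symmetric] norm_power
  using norm_wt_le[OF assms, of "Suc k" for k]
  by (intro prod_mono conjI power_mono zero_le_power norm_ge_zero) simp

lemma norm_chain_prod_one_le:
  "norm (chain_prod (\<lambda>m. 1 / (of_nat m + 1)) b m :: 'a::real_normed_field)
    \<le> chain_prod (\<lambda>m. 1 / (real m + 1)) b m"
  by (rule norm_chain_prod_le[OF minorant_one])

lemma chain_prod_nonneg: "(\<And>m. y m \<ge> (0 :: real)) \<Longrightarrow> chain_prod y b m \<ge> 0"
  by (simp add: chain_prod_def prod_nonneg)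

lemma finite_lt: "finite {m. lt c m a}"
  by (cases c) (auto simp: lt_def)

lemma path_sum_replicate:
  "path_sum \<alpha> (w @ replicate j Xm1) (Suc a) = path_sum \<alpha> w (Suc a) * (1 / (of_nat a + \<alpha>)) ^ j"
proof (induction j)
  case (Suc j)
  have "w @ replicate (Suc j) Xm1 = (w @ replicate j Xm1) @ [Xm1]"
    by (simp add: replicate_append_same flip: replicate_Suc)
  then show ?case using Suc by (simp only: path_sum_snoc) simp
qed simp

lemma path_sum_block:
  assumes "k \<ge> 1" and w: "w \<noteq> []"
  shows "path_sum \<alpha> (w @ z c k) (Suc a) =
    (\<Sum>m | lt c m a. path_sum \<alpha> w (Suc m)) * (1 / (of_nat a + \<alpha>)) ^ k"
proof -
  obtain j where k: "k = Suc j" using assms(1) by (cases k) auto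
  have set: "{m. step (if c then X1 else X0) m (Suc a)} = insert 0 (Suc ` {m. lt c m a})"
    by (auto simp: lt_def image_iff elim: less_natE) (metis less_Suc_eq_0_disj, metis le_Suc_eq not0_implies_Suc Suc_le_mono)
  have "(\<Sum>m | step (if c then X1 else X0) m (Suc a). path_sum \<alpha> w m)
      = (\<Sum>m | lt c m a. path_sum \<alpha> w (Suc m))"
    unfolding set using path_sum_0[OF w, of \<alpha>] finite_lt
    by (subst sum.insert) (auto simp: sum.reindex)
  moreover have "w @ z c k = (w @ [if c then X1 else X0]) @ replicate j Xm1"
    by (simp add: z_def k)
  ultimately show ?thesis by (simp only: path_sum_replicate path_sum_snoc) (simp add: k)
qed

lemma path_sum_first_block:
  assumes "k \<ge> 1"
  shows "path_sum \<alpha> (z True k) (Suc a) = (1 / (of_nat a + \<alpha>)) ^ k"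
proof -
  obtain j where k: "k = Suc j" using assms(1) by (cases k) auto
  have "z True k = ([] @ [X1]) @ replicate j Xm1" by (simp add: z_def k)
  moreover have "(\<Sum>m | m < Suc a. of_bool (m = 0)) = (1 :: 'a)"
    using sum.delta'[of "{m. m < Suc a}" 0 "\<lambda>_. 1 :: 'a"] by (simp add: of_bool_def if_distrib eq_commute cong: if_cong)
  ultimately show ?thesis by (simp only: path_sum_replicate path_sum_snoc) (simp add: k)
qed

text \<open>
  Admissibility without the condition on the last exponent, which is not inherited by initial
  segments and would obstruct induction from the right.
\<close>

definition word_blocks :: "(bool \<times> nat) list \<Rightarrow> bool" where
  "word_blocks b \<longleftrightarrow> b \<noteq> [] \<and> fst (hd b) \<and> (\<forall>(c, k)\<in>set b. k \<ge> 1)"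

text \<open>
  A path for \<open>zprod b\<close> is determined by its values at the beginnings of the blocks, and these form a
  chain.
\<close>

lemma path_sum_zprod:
  assumes "word_blocks b"
  shows "finite (chains_to b a) \<and>
    path_sum \<alpha> (zprod b) (Suc a) = (\<Sum>m\<in>chains_to b a. chain_prod (\<lambda>m. 1 / (of_nat m + \<alpha>)) b m)"
  using assms
proof (induction b arbitrary: a rule: rev_induct)
  case (snoc x b)
  obtain c k where x: "x = (c, k)" by force
  have k: "k \<ge> 1" using snoc.prems by (auto simp: word_blocks_def x)
  show ?case
  proof (cases "b = []")
    case True
    then have "c" using snoc.prems by (simp add: word_blocks_def x)
    moreover have "chains_to [x] a = {[a]}" by (auto simp: chains_singleton)
    ultimately show ?thesis using True path_sum_first_block[OF k, of \<alpha> a]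
      by (simp add: x zprod_def chain_prod_def)
  next
    case False
    then have wb: "word_blocks b" using snoc.prems by (auto simp: word_blocks_def)
    have fin: "finite (chains_to b a)" for a using snoc.IH[OF wb] by blast
    have sum: "path_sum \<alpha> (zprod b) (Suc a)
        = (\<Sum>m\<in>chains_to b a. chain_prod (\<lambda>m. 1 / (of_nat m + \<alpha>)) b m)" for a
      using snoc.IH[OF wb] by blast
    have zb: "zprod b \<noteq> []" using False by (cases b) (auto simp: zprod_simps)
    have "path_sum \<alpha> (zprod (b @ [x])) (Suc a) =
        (\<Sum>m' | lt c m' a. \<Sum>m\<in>chains_to b m'. chain_prod (\<lambda>m. 1 / (of_nat m + \<alpha>)) b m)
          * (1 / (of_nat a + \<alpha>)) ^ k"
    proof -
      have "zprod (b @ [x]) = zprod b @ z c k" by (simp add: x zprod_def)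
      then show ?thesis by (simp only: path_sum_block[OF k zb] sum)
    qed
    also have "\<dots> = (\<Sum>m\<in>(\<Union>m'\<in>{m'. lt c m' a}. chains_to b m').
        chain_prod (\<lambda>m. 1 / (of_nat m + \<alpha>)) b m) * (1 / (of_nat a + \<alpha>)) ^ k"
      by (subst sum.UNION_disjoint) (use fin finite_lt in auto)
    also have "\<dots> = (\<Sum>m\<in>(\<Union>m'\<in>{m'. lt c m' a}. chains_to b m').
        chain_prod (\<lambda>m. 1 / (of_nat m + \<alpha>)) (b @ [x]) (m @ [a]))"
      unfolding sum_distrib_right
      by (rule sum.cong) (auto simp: x chain_prod_snoc chains_def)
    also have "\<dots> = (\<Sum>m\<in>chains_to (b @ [x]) a. chain_prod (\<lambda>m. 1 / (of_nat m + \<alpha>)) (b @ [x]) m)"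
      unfolding x chains_to_snoc[OF False] by (subst sum.reindex) (auto simp: inj_on_def)
    finally show ?thesis
      unfolding x chains_to_snoc[OF False] using fin finite_lt by blast
  qed
qed (simp add: word_blocks_def)

lemma has_sum_chains_iff:
  "(f has_sum s) (chains b) \<longleftrightarrow> ((\<lambda>(a, m). f m) has_sum s) (SIGMA a:UNIV. chains_to b a)"
  by (rule has_sum_reindex_bij_witness[where i = snd and j = "\<lambda>m. (last m, m)"]) auto

lemma has_sum_path_sum_shift:
  assumes "w \<noteq> []"
  shows "((\<lambda>n. path_sum \<alpha> w n * \<phi> n) has_sum s) UNIV \<longleftrightarrow>
    ((\<lambda>n. path_sum \<alpha> w (Suc n) * \<phi> (Suc n)) has_sum s) UNIV"
proof -
  have "((\<lambda>n. path_sum \<alpha> w n * \<phi> n) has_sum s) UNIV \<longleftrightarrow>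
      ((\<lambda>n. path_sum \<alpha> w n * \<phi> n) has_sum s) (range Suc)"
  proof (rule has_sum_cong_neutral)
    fix x assume "x \<in> UNIV - range Suc"
    then have "x = 0" by (cases x) auto
    then show "path_sum \<alpha> w x * \<phi> x = 0" by (simp add: path_sum_0[OF assms])
  qed auto
  also have "\<dots> \<longleftrightarrow> ((\<lambda>n. path_sum \<alpha> w (Suc n) * \<phi> (Suc n)) has_sum s) UNIV"
    by (subst has_sum_reindex) (auto simp: o_def)
  finally show ?thesis .
qed

lemma zprod_nonempty: "word_blocks b \<Longrightarrow> zprod b \<noteq> []"
  by (cases b) (auto simp: word_blocks_def zprod_simps)

lemma chain_fiber_has_sum:
  assumes "word_blocks b"
  shows "((\<lambda>m. chain_prod (\<lambda>m. 1 / (of_nat m + \<alpha>)) b m * \<phi> (Suc (last m))) has_sum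
    path_sum \<alpha> (zprod b) (Suc a) * \<phi> (Suc a)) (chains_to b a)"
  using has_sum_finite[of "chains_to b a" "\<lambda>m. chain_prod (\<lambda>m. 1 / (of_nat m + \<alpha>)) b m * \<phi> (Suc (last m))"]
    path_sum_zprod[OF assms, of a \<alpha>] by (simp add: sum_distrib_right)

lemma summable_chains:
  assumes "word_blocks b" "\<beta> > 0" "\<And>n. \<phi> n \<ge> 0"
    and "(\<lambda>n. path_sum \<beta> (zprod b) n * \<phi> n) summable_on UNIV"
  shows "(\<lambda>m. chain_prod (\<lambda>m. 1 / (real m + \<beta>)) b m * \<phi> (Suc (last m))) summable_on chains b"
proof -
  let ?f = "\<lambda>m. chain_prod (\<lambda>m. 1 / (real m + \<beta>)) b m * \<phi> (Suc (last m))"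
  have "(\<lambda>(a, m). ?f m) summable_on (SIGMA a:UNIV. chains_to b a)"
  proof (rule summable_on_SigmaI[where g = "\<lambda>a. path_sum \<beta> (zprod b) (Suc a) * \<phi> (Suc a)"])
    show "(\<lambda>a. path_sum \<beta> (zprod b) (Suc a) * \<phi> (Suc a)) summable_on UNIV"
      using assms(4) has_sum_path_sum_shift[OF zprod_nonempty[OF assms(1)], of \<beta> \<phi>]
      by (auto simp: summable_on_def)
  qed (use chain_fiber_has_sum[OF assms(1), of \<beta> \<phi>] assms(2,3) in
      \<open>auto simp: chain_prod_def intro!: mult_nonneg_nonneg prod_nonneg\<close>)
  then show ?thesis by (simp add: summable_on_def has_sum_chains_iff)
qed

lemma has_sum_chains_imp:
  fixes \<alpha> :: "'a::{real_normed_field,banach}"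
  assumes "word_blocks b"
    and "((\<lambda>m. chain_prod (\<lambda>m. 1 / (of_nat m + \<alpha>)) b m * \<phi> (Suc (last m))) has_sum s) (chains b)"
  shows "((\<lambda>n. path_sum \<alpha> (zprod b) n * \<phi> n) has_sum s) UNIV"
  unfolding has_sum_path_sum_shift[OF zprod_nonempty[OF assms(1)]]
  by (rule has_sum_SigmaD[OF assms(2)[unfolded has_sum_chains_iff]])
    (use chain_fiber_has_sum[OF assms(1), of \<alpha> \<phi>] in simp)

section \<open>Resolvents and majorants of power series\<close>

text \<open>
  The power series of \<open>1 / (a - x)\<close> in \<open>x\<close>.
\<close>

definition resolvent :: "'a::field \<Rightarrow> 'a fps" where
  "resolvent a = Abs_fps (\<lambda>r. (1 / a) ^ Suc r)"

lemma resolvent_nth: "resolvent a $ r = (1 / a) ^ Suc r"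
  by (simp add: resolvent_def)

lemma resolvent_power_nth:
  fixes a :: "'a::field_char_0"
  assumes "k \<ge> 1"
  shows "(resolvent a ^ k) $ r = of_nat ((k + r - 1) choose r) * (1 / a) ^ (k + r)"
proof -
  have "resolvent a = fps_const (1 / a) * inverse (1 - fps_const (1 / a) * fps_X)"
    using one_minus_const_fps_X_neg_power'[of 1 "1 / a"]
    by (simp add: fps_eq_iff resolvent_nth)
  then have "resolvent a ^ k = fps_const ((1 / a) ^ k) * inverse ((1 - fps_const (1 / a) * fps_X) ^ k)"
    by (simp only: power_mult_distrib fps_const_power fps_inverse_power)
  then show ?thesis
    using assms by (simp only: one_minus_const_fps_X_neg_power' fps_mult_left_const_nth)
      (simp add: one_minus_const_fps_X_neg_power' power_add)
qed

lemma resolvent_sums: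
  fixes a x :: "'a::{real_normed_field,banach}"
  assumes "norm x < norm a"
  shows "(\<lambda>r. resolvent a $ r * x ^ r) sums (1 / (a - x))"
proof -
  have a: "a \<noteq> 0" "a - x \<noteq> 0" using assms by auto
  have "norm (x / a) < 1" using assms a by (simp add: norm_divide)
  from sums_mult[OF geometric_sums[OF this], of "1 / a"]
  show ?thesis using a by (simp add: resolvent_nth power_divide field_simps)
qed

lemma resolvent_conv_radius:
  fixes a :: "'a::{real_normed_field,banach}"
  shows "fps_conv_radius (resolvent a) \<ge> norm a"
  unfolding fps_conv_radius_def
proof (rule conv_radius_geI_ex)
  fix r :: real assume "0 < r" "ereal r < ereal (norm a)"
  then show "\<exists>z :: 'a. norm z = r \<and> summable (\<lambda>n. resolvent a $ n * z ^ n)"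
    using resolvent_sums[of "of_real r" a] by (intro exI[of _ "of_real r"]) (auto simp: sums_iff)
qed

definition conv_at :: "'a::{real_normed_field,banach} fps \<Rightarrow> 'a \<Rightarrow> 'a \<Rightarrow> bool" where
  "conv_at f x v \<longleftrightarrow> ereal (norm x) < fps_conv_radius f \<and> eval_fps f x = v"

lemma conv_at_mult: "conv_at f x v \<Longrightarrow> conv_at g x w \<Longrightarrow> conv_at (f * g) x (v * w)"
  using order.strict_trans2[OF _ fps_conv_radius_mult[of f g], of "ereal (norm x)"]
  by (simp add: conv_at_def eval_fps_mult)

lemma conv_at_const: "conv_at (fps_const c) x c"
  by (simp add: conv_at_def)

lemma conv_at_one: "conv_at 1 x 1"
  using conv_at_const[of 1 x] by simp

lemma conv_at_power: "conv_at f x v \<Longrightarrow> conv_at (f ^ n) x (v ^ n)"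
  by (induction n) (auto intro: conv_at_mult conv_at_one)

lemma conv_at_prod: "(\<And>i. i \<in> A \<Longrightarrow> conv_at (f i) x (v i)) \<Longrightarrow> conv_at (\<Prod>i\<in>A. f i) x (\<Prod>i\<in>A. v i)"
  by (induction A rule: infinite_finite_induct) (auto intro: conv_at_mult conv_at_one)

lemma conv_at_resolvent:
  assumes "norm x < norm a" shows "conv_at (resolvent a) x (1 / (a - x))"
proof -
  have "ereal (norm x) < fps_conv_radius (resolvent a)"
    using assms resolvent_conv_radius[of a] by (meson ereal_less_eq(3) less_le_trans less_ereal.simps(1))
  then show ?thesis using resolvent_sums[OF assms] by (auto simp: conv_at_def eval_fps_def sums_iff)
qed

text \<open>
  Coefficientwise majorants are compatible with products, so for the products of resolvents below it
  suffices to compare \<open>1 / (n + \<alpha> - x)\<close> with \<open>1 / (n + \<beta> - x)\<close>.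
\<close>

definition dominated :: "'a::real_normed_field fps \<Rightarrow> real fps \<Rightarrow> bool" where
  "dominated f g \<longleftrightarrow> (\<forall>r. norm (f $ r) \<le> g $ r)"

lemma dominated_mult:
  assumes "dominated f f'" "dominated g g'" shows "dominated (f * g) (f' * g')"
  unfolding dominated_def fps_mult_nth
proof (intro allI order.trans[OF norm_sum] sum_mono)
  fix r i
  have "norm (f $ i) \<le> f' $ i" "norm (g $ (r - i)) \<le> g' $ (r - i)"
    using assms by (simp_all add: dominated_def)
  then show "norm (f $ i * g $ (r - i)) \<le> f' $ i * g' $ (r - i)"
    unfolding norm_mult by (intro mult_mono) (auto intro: order.trans[OF norm_ge_zero])
qed

lemma dominated_const: "norm c \<le> c' \<Longrightarrow> dominated (fps_const c) (fps_const c')"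
  by (simp add: dominated_def fps_const_def)

lemma dominated_one: "dominated 1 1"
  by (simp add: dominated_def)

lemma dominated_power: "dominated f f' \<Longrightarrow> dominated (f ^ n) (f' ^ n)"
  by (induction n) (auto intro: dominated_mult dominated_one)

lemma dominated_prod: "(\<And>i. i \<in> A \<Longrightarrow> dominated (f i) (g i)) \<Longrightarrow> dominated (\<Prod>i\<in>A. f i) (\<Prod>i\<in>A. g i)"
  by (induction A rule: infinite_finite_induct) (auto intro: dominated_mult dominated_one)

lemma dominated_resolvent:
  assumes "minorant \<beta> \<alpha>"
  shows "dominated (resolvent (of_nat n + \<alpha>)) (resolvent (real n + \<beta>))"
proof -
  have "real n + \<beta> > 0" "real n + \<beta> \<le> norm (of_nat n + \<alpha>)"
    using assms by (auto simp: minorant_def add_nonneg_pos)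
  then show ?thesis
    unfolding dominated_def resolvent_nth norm_power norm_divide norm_one
    by (intro allI power_mono divide_left_mono mult_pos_pos) auto
qed

text \<open>
  Tonelli: since the coefficients of \<open>G i\<close> are nonnegative, summability of the values \<open>G i\<close> at the
  single point \<open>t > 0\<close> gives absolute summability of all terms \<open>F i $ r * x ^ r\<close> for
  \<open>\<bar>x\<bar> \<le> t\<close>, and the two summations can be interchanged.
\<close>

lemma coefficientwise_infsum:
  fixes F :: "'i \<Rightarrow> 'a::{real_normed_field,banach} fps" and G :: "'i \<Rightarrow> real fps" and t :: real
  assumes dom: "\<And>i. i \<in> I \<Longrightarrow> dominated (F i) (G i)"
    and conv: "\<And>i. i \<in> I \<Longrightarrow> conv_at (G i) t (g i)"
    and summ: "g summable_on I" and t: "t > 0"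
  shows "\<And>r. (\<lambda>i. G i $ r) summable_on I"
    and "\<And>x. norm x < t \<Longrightarrow> conv_at (Abs_fps (\<lambda>r. \<Sum>\<^sub>\<infinity>i\<in>I. F i $ r)) x (\<Sum>\<^sub>\<infinity>i\<in>I. eval_fps (F i) x)"
proof -
  have nonneg: "G i $ r \<ge> 0" if "i \<in> I" for i r
    using dom[OF that] order.trans[OF norm_ge_zero] unfolding dominated_def by blast
  have Gsums: "(\<lambda>r. G i $ r * t ^ r) sums g i" if "i \<in> I" for i
    using sums_eval_fps[of t "G i"] conv[OF that] by (simp add: conv_at_def)
  have Ghs: "((\<lambda>r. G i $ r * t ^ r) has_sum g i) UNIV" if "i \<in> I" for i
    by (rule sums_nonneg_imp_has_sum[OF Gsums[OF that]]) (use nonneg[OF that] t in simp)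
  have GS: "(\<lambda>(i, r). G i $ r * t ^ r) summable_on (I \<times> UNIV)"
    by (rule summable_on_SigmaI[where g = g]) (use Ghs summ nonneg t in auto)
  have GS': "(\<lambda>(r, i). G i $ r * t ^ r) summable_on (UNIV \<times> I)"
    using GS summable_on_swap[where f = "\<lambda>(i, r). G i $ r * t ^ r" and A = I and B = UNIV] by simp
  have Gr: "(\<lambda>i. G i $ r * t ^ r) summable_on I" for r
    using summable_on_SigmaD1[OF GS', of r] by simp
  show "(\<lambda>i. G i $ r) summable_on I" for r
    using summable_on_cmult_left[OF Gr[of r], of "1 / t ^ r"] t by simp
  let ?L = "Abs_fps (\<lambda>r. \<Sum>\<^sub>\<infinity>i\<in>I. F i $ r)"
  have main: "(\<lambda>r. ?L $ r * x ^ r) sums (\<Sum>\<^sub>\<infinity>i\<in>I. eval_fps (F i) x)" if x: "norm x \<le> t" for x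
  proof -
    have le: "norm (F i $ r * x ^ r) \<le> G i $ r * t ^ r" if "i \<in> I" for i r
      unfolding norm_mult norm_power using dom[OF that] x nonneg[OF that]
      by (intro mult_mono power_mono) (auto simp: dominated_def)
    have "(\<lambda>(i, r). F i $ r * x ^ r) summable_on (I \<times> UNIV)"
      by (rule summable_on_norm_le[OF GS]) (use le in auto)
    then obtain s where s: "((\<lambda>(i, r). F i $ r * x ^ r) has_sum s) (I \<times> UNIV)"
      by (auto simp: summable_on_def)
    have "((\<lambda>r. F i $ r * x ^ r) has_sum eval_fps (F i) x) UNIV" if "i \<in> I" for i
    proof (rule norm_summable_imp_has_sum)
      show *: "summable (\<lambda>r. norm (F i $ r * x ^ r))"
        by (rule summable_comparison_test'[OF sums_summable[OF Gsums[OF that]], where N = 0])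
          (use le[OF that] in simp)
      show "(\<lambda>r. F i $ r * x ^ r) sums eval_fps (F i) x"
        unfolding eval_fps_def by (rule summable_sums[OF summable_norm_cancel[OF *]])
    qed
    then have s1: "((\<lambda>i. eval_fps (F i) x) has_sum s) I"
      by (intro has_sum_SigmaD[OF s]) auto
    have s2: "((\<lambda>(r, i). F i $ r * x ^ r) has_sum s) (UNIV \<times> I)"
      using s has_sum_swap[where f = "\<lambda>(i, r). F i $ r * x ^ r" and A = I and B = UNIV] by simp
    have "((\<lambda>i. F i $ r * x ^ r) has_sum (?L $ r * x ^ r)) I" for r
    proof -
      have "(\<lambda>i. F i $ r) summable_on I"
        by (rule summable_on_norm_le[OF \<open>(\<lambda>i. G i $ r) summable_on I\<close>])
          (use dom in \<open>auto simp: dominated_def\<close>)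
      then have "((\<lambda>i. F i $ r) has_sum (?L $ r)) I"
        by simp
      then show ?thesis by (rule has_sum_cmult_left)
    qed
    then have "((\<lambda>r. ?L $ r * x ^ r) has_sum s) UNIV"
      by (intro has_sum_SigmaD[OF s2]) auto
    then show ?thesis using has_sum_imp_sums infsumI[OF s1] by blast
  qed
  show "conv_at ?L x (\<Sum>\<^sub>\<infinity>i\<in>I. eval_fps (F i) x)" if x: "norm x < t" for x
  proof -
    have "fps_conv_radius ?L \<ge> ereal t"
      unfolding fps_conv_radius_def
    proof (rule conv_radius_geI_ex)
      fix r :: real assume "0 < r" "ereal r < ereal t"
      then show "\<exists>z :: 'a. norm z = r \<and> summable (\<lambda>n. ?L $ n * z ^ n)"
        using main[of "of_real r"] by (intro exI[of _ "of_real r"]) (auto simp: sums_iff)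
    qed
    moreover have "eval_fps ?L x = (\<Sum>\<^sub>\<infinity>i\<in>I. eval_fps (F i) x)"
      using main[of x] x by (simp add: eval_fps_def sums_iff)
    ultimately show ?thesis using x unfolding conv_at_def
      by (meson ereal_less_eq(3) less_le_trans less_ereal.simps(1))
  qed
qed

section \<open>Duality of the Taylor coefficients\<close>

text \<open>
  The following two series are the terms of both sides of the identity for \<open>r = 0\<close>, with \<open>\<alpha> - x\<close> in
  place of \<open>\<alpha>\<close>, expanded in powers of \<open>x\<close>.
\<close>

definition zeta_fps :: "'a::field \<Rightarrow> (bool \<times> nat) list \<Rightarrow> nat list \<Rightarrow> 'a fps" where
  "zeta_fps \<alpha> b m = chain_prod (\<lambda>m. resolvent (of_nat m + \<alpha>)) b m"

definition Hstar_fps :: "'a::field_char_0 \<Rightarrow> (bool \<times> nat) list \<Rightarrow> nat list \<Rightarrow> 'a fps" where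
  "Hstar_fps \<alpha> b m = fps_const (chain_prod (\<lambda>m. 1 / (of_nat m + 1)) b m * fact (Suc (last m))) *
     (\<Prod>j<Suc (last m). resolvent (of_nat j + \<alpha>))"

lemma minorant_norm_less:
  assumes "minorant \<beta> \<alpha>" "norm x < \<beta>" shows "norm x < norm (of_nat n + \<alpha>)"
proof -
  have "real n + \<beta> \<le> norm (of_nat n + \<alpha>)" using assms by (simp add: minorant_def)
  then show ?thesis using assms(2) by linarith
qed

lemma conv_at_zeta_fps:
  assumes "minorant \<beta> \<alpha>" "norm x < \<beta>"
  shows "conv_at (zeta_fps \<alpha> b m) x (chain_prod (\<lambda>m. 1 / (of_nat m + (\<alpha> - x))) b m)"
  unfolding zeta_fps_def chain_prod_def add_diff_eq
  by (intro conv_at_prod conv_at_power conv_at_resolvent minorant_norm_less[OF assms])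

lemma conv_at_Hstar_fps:
  assumes "minorant \<beta> \<alpha>" "norm x < \<beta>"
  shows "conv_at (Hstar_fps \<alpha> b m) x
    (chain_prod (\<lambda>m. 1 / (of_nat m + 1)) b m * connector (\<alpha> - x) 0 (Suc (last m)))"
proof -
  have "conv_at (Hstar_fps \<alpha> b m) x ((chain_prod (\<lambda>m. 1 / (of_nat m + 1)) b m * fact (Suc (last m))) *
      (\<Prod>j<Suc (last m). 1 / (of_nat j + \<alpha> - x)))"
    unfolding Hstar_fps_def
    by (intro conv_at_mult conv_at_const conv_at_prod conv_at_resolvent minorant_norm_less[OF assms])
  moreover have "(\<Prod>j<n. 1 / (of_nat j + \<alpha> - x)) = 1 / pochhammer (\<alpha> - x) n" for n
    by (simp add: pochhammer_prod prod_dividef atLeast0LessThan algebra_simps)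
  ultimately show ?thesis by (simp add: connector_def)
qed

lemma dominated_zeta_fps:
  "minorant \<beta> \<alpha> \<Longrightarrow> dominated (zeta_fps \<alpha> b m) (zeta_fps \<beta> b m)"
  unfolding zeta_fps_def chain_prod_def
  using dominated_resolvent[of \<beta> \<alpha>] by (intro dominated_prod dominated_power) simp

lemma dominated_Hstar_fps:
  assumes "minorant \<beta> \<alpha>" shows "dominated (Hstar_fps \<alpha> b m) (Hstar_fps \<beta> b m)"
proof -
  have "norm (chain_prod (\<lambda>m. 1 / (of_nat m + 1)) b m * fact (Suc (last m)) :: 'a)
      \<le> chain_prod (\<lambda>m. 1 / (real m + 1)) b m * fact (Suc (last m))"
    unfolding norm_mult norm_fact by (intro mult_right_mono norm_chain_prod_one_le) simp
  then show ?thesis unfolding Hstar_fps_def using dominated_resolvent[OF assms]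
    by (intro dominated_mult dominated_const dominated_prod) simp_all
qed

text \<open>
  For \<open>\<bar>x\<bar> < Re \<alpha> / 2\<close> both generating functions are the two sides of \<open>path_sum_duality\<close> at
  \<open>\<alpha> - x\<close>, so their coefficients agree. The majorants converge at \<open>t = Re \<alpha> / 2\<close> because the
  shift \<open>Re \<alpha> - t\<close> is still positive.
\<close>

lemma coefficientwise_duality:
  fixes \<alpha> :: complex
  assumes \<alpha>: "Re \<alpha> > 0" and b: "word_blocks b" "word_blocks b'"
    and w: "zprod b = X1 # es @ [Xm1]" and w': "zprod b' = rev (map opp (zprod b))"
  shows "(\<lambda>m. zeta_fps (Re \<alpha>) b m $ r) summable_on chains b"
    and "(\<lambda>m. Hstar_fps (Re \<alpha>) b' m $ r) summable_on chains b'"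
    and "(\<Sum>\<^sub>\<infinity>m\<in>chains b. zeta_fps \<alpha> b m $ r) = (\<Sum>\<^sub>\<infinity>m\<in>chains b'. Hstar_fps \<alpha> b' m $ r)"
proof -
  define \<beta> t where "\<beta> = Re \<alpha>" and "t = \<beta> / 2"
  have t: "t > 0" "t < \<beta>" "\<beta> - t > 0" using \<alpha> by (auto simp: t_def \<beta>_def)
  have mina: "minorant \<beta> \<alpha>" unfolding \<beta>_def by (rule minorant_Re[OF \<alpha>])
  note minb = minorant_self[OF mina]
  have nt: "norm t < \<beta>" using t by simp
  have minc: "minorant \<gamma> \<gamma>" if "\<gamma> > 0" for \<gamma> :: real using minorant_refl[OF that] by simp
  have zsumm: "chain_prod (\<lambda>m. 1 / (real m + \<gamma>)) b summable_on chains b" if "\<gamma> > 0" for \<gamma>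
    using summable_chains[OF b(1) that, of "\<lambda>_. 1"] path_sum_duality(1)[OF minc[OF that] w] by simp
  have hsumm: "(\<lambda>m. chain_prod (\<lambda>m. 1 / (real m + 1)) b' m * connector \<gamma> 0 (Suc (last m)))
      summable_on chains b'" if "\<gamma> > 0" for \<gamma>
    using summable_chains[OF b(2), of 1 "connector \<gamma> 0"] path_sum_duality(2)[OF minc[OF that] w]
      connector_nonneg[OF that] by (simp add: w')
  note L = coefficientwise_infsum[OF dominated_zeta_fps[OF mina, of b] conv_at_zeta_fps[OF minb nt, of b]
      zsumm[OF t(3)] t(1)]
  note R = coefficientwise_infsum[OF dominated_Hstar_fps[OF mina, of b'] conv_at_Hstar_fps[OF minb nt, of b']
      hsumm[OF t(3)] t(1)]
  show "(\<lambda>m. zeta_fps (Re \<alpha>) b m $ r) summable_on chains b"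
    using L(1) unfolding \<beta>_def by blast
  show "(\<lambda>m. Hstar_fps (Re \<alpha>) b' m $ r) summable_on chains b'"
    using R(1) unfolding \<beta>_def by blast
  define FL where "FL = Abs_fps (\<lambda>r. \<Sum>\<^sub>\<infinity>m\<in>chains b. zeta_fps \<alpha> b m $ r)"
  define FR where "FR = Abs_fps (\<lambda>r. \<Sum>\<^sub>\<infinity>m\<in>chains b'. Hstar_fps \<alpha> b' m $ r)"
  have eq: "eval_fps FL x = eval_fps FR x" if x: "norm x < t" for x
  proof -
    have xb: "norm x < \<beta>" using x t by simp
    have Re: "Re (\<alpha> - x) > 0" using xb complex_Re_le_cmod[of x] by (simp add: \<beta>_def)
    note minx = minorant_Re[OF Re]
    have L2: "eval_fps FL x = (\<Sum>\<^sub>\<infinity>m\<in>chains b. chain_prod (\<lambda>m. 1 / (of_nat m + (\<alpha> - x))) b m)"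
      using L(2)[OF x] conv_at_zeta_fps[OF mina xb, of b] by (simp add: conv_at_def FL_def)
    have R2: "eval_fps FR x = (\<Sum>\<^sub>\<infinity>m\<in>chains b'.
        chain_prod (\<lambda>m. 1 / (of_nat m + 1)) b' m * connector (\<alpha> - x) 0 (Suc (last m)))"
      using R(2)[OF x] conv_at_Hstar_fps[OF mina xb, of b'] by (simp add: conv_at_def FR_def)
    have "chain_prod (\<lambda>m. 1 / (of_nat m + (\<alpha> - x))) b summable_on chains b"
      by (rule summable_on_norm_le[OF zsumm[OF Re]]) (rule norm_chain_prod_le[OF minx])
    then have "(chain_prod (\<lambda>m. 1 / (of_nat m + (\<alpha> - x))) b has_sum eval_fps FL x) (chains b)"
      unfolding L2 by (rule has_sum_infsum)
    then have s1: "(path_sum (\<alpha> - x) (zprod b) has_sum eval_fps FL x) UNIV"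
      using has_sum_chains_imp[OF b(1), of "\<alpha> - x" "\<lambda>_. 1"] by simp
    have "(\<lambda>m. chain_prod (\<lambda>m. 1 / (of_nat m + 1)) b' m * connector (\<alpha> - x) 0 (Suc (last m)))
        summable_on chains b'"
    proof (rule summable_on_norm_le[OF hsumm[OF Re]])
      show "norm (chain_prod (\<lambda>m. 1 / (of_nat m + 1)) b' m * connector (\<alpha> - x) 0 (Suc (last m)))
          \<le> chain_prod (\<lambda>m. 1 / (real m + 1)) b' m * connector (Re (\<alpha> - x)) 0 (Suc (last m))" for m
        unfolding norm_mult
        by (intro mult_mono norm_chain_prod_one_le norm_connector_le[OF minx] chain_prod_nonneg norm_ge_zero) simp
    qed
    then have "((\<lambda>m. chain_prod (\<lambda>m. 1 / (of_nat m + 1)) b' m * connector (\<alpha> - x) 0 (Suc (last m)))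
        has_sum eval_fps FR x) (chains b')"
      unfolding R2 by (rule has_sum_infsum)
    then have s2: "((\<lambda>n. path_sum 1 (zprod b') n * connector (\<alpha> - x) 0 n) has_sum eval_fps FR x) UNIV"
      using has_sum_chains_imp[OF b(2), of 1 "connector (\<alpha> - x) 0"] by simp
    from path_sum_duality(3)[OF minx w, folded w'] s1 s2 show ?thesis
      using has_sum_unique by metis
  qed
  have "FL = FR"
  proof (rule eval_fps_eqD)
    show "fps_conv_radius FL > 0" "fps_conv_radius FR > 0"
      using L(2)[of 0] R(2)[of 0] t unfolding conv_at_def FL_def FR_def by (auto simp: zero_ereal_def)
    show "\<forall>\<^sub>F z in nhds 0. eval_fps FL z = eval_fps FR z"
      unfolding eventually_nhds_metric using eq t(1) by (auto simp: dist_norm)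
  qed
  then show "(\<Sum>\<^sub>\<infinity>m\<in>chains b. zeta_fps \<alpha> b m $ r) = (\<Sum>\<^sub>\<infinity>m\<in>chains b'. Hstar_fps \<alpha> b' m $ r)"
    by (simp add: fps_eq_iff FL_def FR_def)
qed

section \<open>The Hurwitz side\<close>

lemma has_sum_sum_finite:
  fixes f :: "'r \<Rightarrow> 'i \<Rightarrow> 'a::topological_comm_monoid_add"
  assumes "finite R" "\<And>r. r \<in> R \<Longrightarrow> (f r has_sum s r) A"
  shows "((\<lambda>x. \<Sum>r\<in>R. f r x) has_sum (\<Sum>r\<in>R. s r)) A"
  using assms
proof (induction R rule: finite_induct)
  case (insert r R)
  have "((\<lambda>x. f r x + (\<Sum>r\<in>R. f r x)) has_sum (s r + (\<Sum>r\<in>R. s r))) A"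
    by (rule has_sum_add) (use insert in auto)
  then show ?case using insert by simp
qed simp

lemma fps_prod_nth_compositions:
  fixes f :: "nat \<Rightarrow> 'a::comm_ring_1 fps"
  assumes "p > 0"
  shows "(\<Prod>i<p. f i) $ r = (\<Sum>rs\<in>compositions p r. \<Prod>i<p. f i $ (rs ! i))"
proof -
  have "{..<p} = {0..p - 1}" using assms by auto
  moreover have "natpermute r (p - 1 + 1) = compositions p r"
    using assms by (auto simp: natpermute_def compositions_def)
  ultimately show ?thesis using fps_prod_nth[of f "p - 1" r] by simp
qed

lemma zeta_superset:
  assumes "finite W" "Poly_Mapping.keys u \<subseteq> W"
  shows "zeta u \<alpha> = (\<Sum>w\<in>W. of_rat (Poly_Mapping.lookup u w) * zeta_word w \<alpha>)"
  unfolding zeta_def using assms by (intro sum.mono_neutral_left) (auto simp: in_keys_iff)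

lemma zeta_add: "zeta (u + u') \<alpha> = zeta u \<alpha> + zeta u' \<alpha>"
proof -
  let ?W = "Poly_Mapping.keys u \<union> Poly_Mapping.keys u'"
  have "Poly_Mapping.keys (u + u') \<subseteq> ?W" by (rule Poly_Mapping.keys_add)
  then show ?thesis
    using zeta_superset[of ?W "u + u'" \<alpha>] zeta_superset[of ?W u \<alpha>] zeta_superset[of ?W u' \<alpha>]
    by (simp add: lookup_add of_rat_add distrib_right sum.distrib)
qed

lemma zeta_single: "zeta (Poly_Mapping.single w c) \<alpha> = of_rat c * zeta_word w \<alpha>"
  using zeta_superset[of "{w}" "Poly_Mapping.single w c" \<alpha>] by simp

lemma zeta_sum:
  "finite A \<Longrightarrow> zeta (\<Sum>i\<in>A. u i) \<alpha> = (\<Sum>i\<in>A. zeta (u i) \<alpha>)"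
  by (induction A rule: finite_induct) (simp_all add: zeta_add, simp add: zeta_def)

definition shift_exponents :: "(bool \<times> nat) list \<Rightarrow> nat list \<Rightarrow> (bool \<times> nat) list" where
  "shift_exponents b rs = map (\<lambda>i. (fst (b ! i), snd (b ! i) + rs ! i)) [0..<length b]"

lemma admissible_shift_exponents:
  assumes "admissible b" "b \<noteq> []"
  shows "admissible (shift_exponents b rs)"
proof -
  have "\<forall>i<length b. snd (b ! i) \<ge> 1" "fst (b ! 0)" "snd (b ! (length b - 1)) \<ge> 2"
    using assms by (auto simp: admissible_def hd_conv_nth last_conv_nth all_set_conv_all_nth
        split_beta)
  then show ?thesis using assms(2)
    by (auto simp: shift_exponents_def admissible_def hd_map last_map trans_le_add1 hd_upt last_upt)
qed

lemma chains_shift_exponents: "chains (shift_exponents b rs) = chains b"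
  by (auto simp: chains_def shift_exponents_def)

lemma zeta_word_zprod:
  assumes "admissible b"
  shows "zeta_word (zprod b) \<alpha> = (\<Sum>\<^sub>\<infinity>m\<in>chains b. chain_prod (\<lambda>m. 1 / (of_nat m + \<alpha>)) b m)"
  unfolding zeta_word_def blocks_zprod[OF assms] Let_def chains_def chain_prod_def
  by (simp add: power_one_over)

lemma zeta_fps_nth:
  fixes \<alpha> :: "'a::field_char_0"
  assumes "word_blocks b"
  shows "zeta_fps \<alpha> b m $ r = (\<Sum>rs\<in>compositions (length b) r.
    (\<Prod>i<length b. of_nat ((snd (b ! i) + rs ! i - 1) choose (rs ! i))) *
    chain_prod (\<lambda>m. 1 / (of_nat m + \<alpha>)) (shift_exponents b rs) m)"
proof -
  have k: "snd (b ! i) \<ge> 1" if "i < length b" for i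
    using assms that by (auto simp: word_blocks_def all_set_conv_all_nth split_beta)
  have "length b > 0" using assms by (simp add: word_blocks_def)
  show ?thesis
    unfolding zeta_fps_def chain_prod_def fps_prod_nth_compositions[OF \<open>length b > 0\<close>]
  proof (rule sum.cong[OF refl])
    fix rs
    have "(\<Prod>i<length b. (resolvent (of_nat (m ! i) + \<alpha>) ^ snd (b ! i)) $ (rs ! i)) =
        (\<Prod>i<length b. of_nat ((snd (b ! i) + rs ! i - 1) choose (rs ! i)) *
          (1 / (of_nat (m ! i) + \<alpha>)) ^ (snd (b ! i) + rs ! i))"
      by (rule prod.cong[OF refl], rule resolvent_power_nth, rule k) simp
    then show "(\<Prod>i<length b. (resolvent (of_nat (m ! i) + \<alpha>) ^ snd (b ! i)) $ (rs ! i)) =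
        (\<Prod>i<length b. of_nat ((snd (b ! i) + rs ! i - 1) choose (rs ! i))) *
        (\<Prod>i<length (shift_exponents b rs).
          (1 / (of_nat (m ! i) + \<alpha>)) ^ snd (shift_exponents b rs ! i))"
      by (simp add: shift_exponents_def prod.distrib)
  qed
qed

text \<open>
  The sum over compositions may be moved inside the series: for each composition the series at the
  shift \<open>\<beta>\<close> is bounded by the series of \<open>zeta_fps \<beta> b m $ r\<close>, whose summands collect nonnegative
  contributions of all compositions.
\<close>

lemma zeta_sigma_b2:
  fixes \<alpha> :: complex
  assumes "v \<in> B0" "v \<noteq> []" and b: "b = blocks v" "word_blocks b"
    and min: "minorant \<beta> \<alpha>" and summ: "(\<lambda>m. zeta_fps \<beta> b m $ r) summable_on chains b"
  shows "zeta (sigma_b2 r v) \<alpha> = (\<Sum>\<^sub>\<infinity>m\<in>chains b. zeta_fps \<alpha> b m $ r)"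
proof -
  have adm: "admissible b" "b \<noteq> []" using zprod_blocks[OF assms(1)] b by (auto simp: word_blocks_def)
  let ?c = "\<lambda>rs. \<Prod>i<length b. (of_nat ((snd (b ! i) + rs ! i - 1) choose (rs ! i)))"
  let ?t = "\<lambda>rs m. chain_prod (\<lambda>m. 1 / (of_nat m + \<alpha>)) (shift_exponents b rs) m"
  have sig: "sigma_b2 r v = (\<Sum>rs\<in>compositions (length b) r.
      Poly_Mapping.single (zprod (shift_exponents b rs)) (?c rs))"
    using assms(2) by (simp add: sigma_b2_def Let_def b(1) shift_exponents_def)
  have "((\<lambda>m. \<Sum>rs\<in>compositions (length b) r. ?c rs * ?t rs m) has_sum
      (\<Sum>rs\<in>compositions (length b) r. ?c rs * (\<Sum>\<^sub>\<infinity>m\<in>chains b. ?t rs m))) (chains b)"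
  proof (rule has_sum_sum_finite[OF finite_compositions])
    fix rs assume rs: "rs \<in> compositions (length b) r"
    have "?t rs summable_on chains b"
    proof (rule summable_on_norm_le[OF summ])
      fix m assume "m \<in> chains b"
      let ?r = "\<lambda>rs. (?c rs :: real) * chain_prod (\<lambda>m. 1 / (real m + \<beta>)) (shift_exponents b rs) m"
      have pos: "chain_prod (\<lambda>m. 1 / (real m + \<beta>)) b' m \<ge> 0" for b'
        using minorant_pos[OF min] by (auto simp: chain_prod_def intro!: prod_nonneg)
      \<comment> \<open>the binomial coefficients are positive because the exponents are\<close>
      have c: "?c rs \<ge> (1 :: real)"
      proof (rule prod_ge_1)
        fix i assume "i \<in> {..<length b}"
        then have "snd (b ! i) \<ge> 1"
          using b(2) by (auto simp: word_blocks_def all_set_conv_all_nth split_beta)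
        then have "(snd (b ! i) + rs ! i - 1) choose (rs ! i) > 0" by simp
        then show "1 \<le> real ((snd (b ! i) + rs ! i - 1) choose (rs ! i))" by linarith
      qed
      have "norm (?t rs m) \<le> chain_prod (\<lambda>m. 1 / (real m + \<beta>)) (shift_exponents b rs) m"
        by (rule norm_chain_prod_le[OF min])
      also have "\<dots> \<le> ?r rs" using mult_right_mono[OF c pos[of "shift_exponents b rs"]] by simp
      also have "\<dots> \<le> (\<Sum>rs\<in>compositions (length b) r. ?r rs)"
        using rs pos by (intro member_le_sum) (auto intro!: mult_nonneg_nonneg prod_nonneg finite_compositions)
      also have "\<dots> = zeta_fps \<beta> b m $ r" by (rule zeta_fps_nth[OF b(2), symmetric])
      finally show "norm (?t rs m) \<le> zeta_fps \<beta> b m $ r" .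
    qed
    then show "((\<lambda>m. ?c rs * ?t rs m) has_sum ?c rs * (\<Sum>\<^sub>\<infinity>m\<in>chains b. ?t rs m)) (chains b)"
      by (intro has_sum_cmult_right has_sum_infsum)
  qed
  then have "(\<Sum>\<^sub>\<infinity>m\<in>chains b. zeta_fps \<alpha> b m $ r) =
      (\<Sum>rs\<in>compositions (length b) r. ?c rs * (\<Sum>\<^sub>\<infinity>m\<in>chains b. ?t rs m))"
    unfolding zeta_fps_nth[OF b(2)] by (rule infsumI)
  moreover have "zeta (sigma_b2 r v) \<alpha> =
      (\<Sum>rs\<in>compositions (length b) r. ?c rs * (\<Sum>\<^sub>\<infinity>m\<in>chains b. ?t rs m))"
    unfolding sig zeta_sum[OF finite_compositions] zeta_single
      zeta_word_zprod[OF admissible_shift_exponents[OF adm]] chains_shift_exponents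
    by (simp add: of_rat_prod)
  ultimately show ?thesis by simp
qed

section \<open>Complete homogeneous sums\<close>

definition geometric_fps :: "'a::comm_ring_1 \<Rightarrow> 'a fps" where
  "geometric_fps y = Abs_fps (\<lambda>r. y ^ r)"

lemma mult_geometric_fps_Suc:
  "(f * geometric_fps y) $ Suc r = f $ Suc r + y * (f * geometric_fps y) $ r"
proof -
  have "(\<Sum>i\<le>r. f $ i * y ^ (Suc r - i)) = (\<Sum>i\<le>r. y * (f $ i * y ^ (r - i)))"
    by (rule sum.cong) (simp_all add: Suc_diff_le mult_ac)
  then show ?thesis
    by (simp add: fps_mult_nth geometric_fps_def atLeast0AtMost sum_distrib_left add.commute)
qed

definition sorted_lists :: "nat \<Rightarrow> nat set \<Rightarrow> nat list set" where
  "sorted_lists r A = {L. length L = r \<and> sorted L \<and> set L \<subseteq> A}"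

lemma finite_sorted_lists: "finite A \<Longrightarrow> finite (sorted_lists r A)"
  by (rule finite_subset[OF _ finite_lists_length_eq[of A r]]) (auto simp: sorted_lists_def)

lemma sorted_lists_0: "sorted_lists 0 A = {[]}"
  by (auto simp: sorted_lists_def)

lemma sorted_lists_Suc:
  assumes "\<forall>a\<in>A. a < k"
  shows "sorted_lists (Suc r) (insert k A) =
    sorted_lists (Suc r) A \<union> (\<lambda>L. L @ [k]) ` sorted_lists r (insert k A)"
proof (rule set_eqI, rule iffI)
  fix L assume L: "L \<in> sorted_lists (Suc r) (insert k A)"
  then obtain L' a where La: "L = L' @ [a]"
    by (cases L rule: rev_cases) (auto simp: sorted_lists_def)
  show "L \<in> sorted_lists (Suc r) A \<union> (\<lambda>L. L @ [k]) ` sorted_lists r (insert k A)"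
  proof (cases "a = k")
    case True
    then show ?thesis using L by (auto simp: La sorted_lists_def sorted_append)
  next
    case False
    then have "a \<in> A" "\<forall>x\<in>set L'. x \<le> a" using L by (auto simp: La sorted_lists_def sorted_append)
    moreover from this have "a < k" using assms by blast
    ultimately have "\<forall>x\<in>set L. x < k" by (auto simp: La)
    then have "k \<notin> set L" by blast
    then show ?thesis using L by (auto simp: sorted_lists_def)
  qed
next
  fix L assume "L \<in> sorted_lists (Suc r) A \<union> (\<lambda>L. L @ [k]) ` sorted_lists r (insert k A)"
  moreover have "\<forall>x\<in>insert k A. x \<le> k" using assms by auto
  ultimately show "L \<in> sorted_lists (Suc r) (insert k A)"
    by (auto simp: sorted_lists_def sorted_append) (metis insertE subsetD order_refl)
qed

text \<open>
  The left-hand side is the complete homogeneous symmetric polynomial of degree \<open>r\<close>, monomials being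
  encoded by sorted lists. In the induction on \<open>A\<close> the lists are split according to whether they end
  in the new maximum \<open>k\<close>; the same recursion holds for multiplication by a geometric series.
\<close>

lemma sum_sorted_lists:
  fixes y :: "nat \<Rightarrow> 'a::comm_ring_1"
  assumes "finite A"
  shows "(\<Sum>L\<in>sorted_lists r A. \<Prod>j<length L. y (L ! j)) = (\<Prod>a\<in>A. geometric_fps (y a)) $ r"
  using assms
proof (induction A arbitrary: r rule: finite_linorder_max_induct)
  case empty
  have "sorted_lists r {} = (if r = 0 then {[]} else {})" by (auto simp: sorted_lists_def)
  then show ?case by simp
next
  case (insert k A)
  let ?P = "\<Prod>a\<in>A. geometric_fps (y a)"
  let ?w = "\<lambda>L. \<Prod>j<length L. y (L ! j)"
  have fin: "finite (sorted_lists r A)" "finite (sorted_lists r (insert k A))" for r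
    using insert.hyps(1) by (auto intro: finite_sorted_lists)
  have kA: "k \<notin> A" using insert.hyps by auto
  have "(\<Sum>L\<in>sorted_lists r (insert k A). ?w L) = (?P * geometric_fps (y k)) $ r"
  proof (induction r)
    case 0
    have "?P $ 0 = 1" using insert.IH[of 0] by (simp add: sorted_lists_0)
    then show ?case by (simp add: sorted_lists_0 geometric_fps_def)
  next
    case (Suc r)
    have "(\<Sum>L\<in>sorted_lists (Suc r) (insert k A). ?w L) =
        (\<Sum>L\<in>sorted_lists (Suc r) A. ?w L) + (\<Sum>L\<in>(\<lambda>L. L @ [k]) ` sorted_lists r (insert k A). ?w L)"
      unfolding sorted_lists_Suc[OF insert.hyps(2)]
      by (rule sum.union_disjoint) (use fin kA in \<open>auto simp: sorted_lists_def\<close>)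
    also have "(\<Sum>L\<in>(\<lambda>L. L @ [k]) ` sorted_lists r (insert k A). ?w L) =
        (\<Sum>L\<in>sorted_lists r (insert k A). y k * ?w L)"
      by (subst sum.reindex) (auto simp: inj_on_def nth_append lessThan_Suc)
    also have "\<dots> = y k * (?P * geometric_fps (y k)) $ r"
      by (simp only: sum_distrib_left[symmetric] Suc.IH)
    finally show ?case by (simp only: mult_geometric_fps_Suc insert.IH)
  qed
  then show ?case using insert.hyps(1) kA by (simp add: mult.commute)
qed

lemma list_product_snoc:
  "{M. length M = Suc q \<and> (\<forall>i<Suc q. M ! i \<in> A i)} =
   (\<lambda>(M, L). M @ [L]) ` ({M. length M = q \<and> (\<forall>i<q. M ! i \<in> A i)} \<times> A q)"
proof (rule set_eqI, rule iffI)
  fix M assume M: "M \<in> {M. length M = Suc q \<and> (\<forall>i<Suc q. M ! i \<in> A i)}"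
  then obtain M' L where snoc: "M = M' @ [L]" by (cases M rule: rev_cases) auto
  have "M' ! i \<in> A i" if "i < q" for i
    using M that by (auto simp: snoc nth_append dest!: spec[of _ i] split: if_splits)
  moreover have "L \<in> A q" using M by (auto simp: snoc nth_append dest!: spec[of _ q])
  ultimately show "M \<in> (\<lambda>(M, L). M @ [L]) ` ({M. length M = q \<and> (\<forall>i<q. M ! i \<in> A i)} \<times> A q)"
    using M by (auto simp: snoc)
qed (auto simp: nth_append less_Suc_eq)

lemma sum_list_product:
  fixes f :: "nat \<Rightarrow> 'b \<Rightarrow> 'a::comm_semiring_1"
  assumes "\<And>i. finite (A i)"
  shows "finite {M. length M = q \<and> (\<forall>i<q. M ! i \<in> A i)} \<and>
    (\<Sum>M | length M = q \<and> (\<forall>i<q. M ! i \<in> A i). \<Prod>i<q. f i (M ! i)) = (\<Prod>i<q. \<Sum>L\<in>A i. f i L)"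
proof (induction q)
  case 0
  have "{M :: 'b list. length M = 0 \<and> (\<forall>i<0. M ! i \<in> A i)} = {[]}" by auto
  then show ?case by simp
next
  case (Suc q)
  let ?S = "{M. length M = q \<and> (\<forall>i<q. M ! i \<in> A i)}"
  have "(\<Sum>M | length M = Suc q \<and> (\<forall>i<Suc q. M ! i \<in> A i). \<Prod>i<Suc q. f i (M ! i)) =
      (\<Sum>(M, L)\<in>?S \<times> A q. (\<Prod>i<q. f i (M ! i)) * f q L)"
    unfolding list_product_snoc
    by (subst sum.reindex)
      (auto simp: inj_on_def nth_append case_prod_unfold mult.commute intro!: sum.cong)
  also have "\<dots> = (\<Sum>M\<in>?S. \<Prod>i<q. f i (M ! i)) * (\<Sum>L\<in>A q. f q L)"
    by (simp add: sum.cartesian_product[symmetric] sum_product)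
  finally show ?case using Suc assms[of q] unfolding list_product_snoc by (simp add: mult.commute)
qed

section \<open>The dual side\<close>

text \<open>
  For a chain \<open>m\<close> the entries of \<open>M\<^sup>(\<^sup>i\<^sup>)\<close> vary in an interval whose upper end is determined by the
  flag of the next block and is the lower end of the following interval. After the last block the
  flag is read as strict, so the last interval ends at \<open>last m\<close> inclusively.
\<close>

definition interval_bound :: "(bool \<times> nat) list \<Rightarrow> nat list \<Rightarrow> nat \<Rightarrow> nat" where
  "interval_bound b m i = (if i = 0 then 0
     else if i < length b \<and> \<not> fst (b ! i) then m ! (i - 1) else Suc (m ! (i - 1)))"

definition Hstar_range :: "(bool \<times> nat) list \<Rightarrow> nat list \<Rightarrow> nat \<Rightarrow> nat set" where
  "Hstar_range b m i = {interval_bound b m i..<interval_bound b m (Suc i)}"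

lemma mem_Hstar_range:
  assumes "i < length b" and "c = (\<lambda>i. if i < length b then fst (b ! i) else True)"
  shows "j \<in> Hstar_range b m i \<longleftrightarrow>
    (i \<ge> 1 \<longrightarrow> lt (c i) (m ! (i - 1)) j) \<and> lt (\<not> c (Suc i)) j (m ! i)"
  using assms(1) unfolding assms(2) by (auto simp: Hstar_range_def interval_bound_def lt_def)

lemma prod_consecutive_intervals:
  fixes u :: "nat \<Rightarrow> nat" and g :: "nat \<Rightarrow> 'a::comm_monoid_mult"
  assumes "u 0 = 0" "\<And>i. i < q \<Longrightarrow> u i \<le> u (Suc i)"
  shows "(\<Prod>i<q. \<Prod>j\<in>{u i..<u (Suc i)}. g j) = (\<Prod>j<u q. g j)"
  using assms(2)
proof (induction q)
  case (Suc q)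
  then have "(\<Prod>i<Suc q. \<Prod>j\<in>{u i..<u (Suc i)}. g j) = (\<Prod>j\<in>{0..<u q}. g j) * (\<Prod>j\<in>{u q..<u (Suc q)}. g j)"
    by (simp add: atLeast0LessThan mult.commute)
  also have "\<dots> = (\<Prod>j\<in>{0..<u (Suc q)}. g j)"
    by (rule prod.atLeastLessThan_concat) (use Suc.prems in auto)
  finally show ?case by (simp add: atLeast0LessThan)
qed (simp add: assms(1))

lemma prod_Hstar_range:
  assumes "m \<in> chains b" "b \<noteq> []"
  shows "(\<Prod>i<length b. \<Prod>j\<in>Hstar_range b m i. g j) = (\<Prod>j<Suc (last m). g j)"
proof -
  have len: "length m = length b" and "m \<noteq> []" using assms by (auto simp: chains_def)
  have "interval_bound b m i \<le> interval_bound b m (Suc i)" if "i < length b" for i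
  proof (cases i)
    case (Suc i')
    then have "lt (fst (b ! i)) (m ! i') (m ! i)" using assms(1) that by (auto simp: chains_def)
    then show ?thesis using that Suc by (auto simp: interval_bound_def lt_def split: if_splits)
  qed (simp add: interval_bound_def)
  moreover have "interval_bound b m (length b) = Suc (last m)"
    using assms(2) len \<open>m \<noteq> []\<close> by (simp add: interval_bound_def last_conv_nth)
  ultimately show ?thesis unfolding Hstar_range_def
    by (subst prod_consecutive_intervals[of "interval_bound b m"]) (auto simp: interval_bound_def)
qed

definition Hstar_lists :: "(bool \<times> nat) list \<Rightarrow> nat list \<Rightarrow> nat list \<Rightarrow> nat list list set" where
  "Hstar_lists b rs m =
     {M. length M = length b \<and> (\<forall>i<length b. M ! i \<in> sorted_lists (rs ! i) (Hstar_range b m i))}"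

lemma lt_le_trans: "lt c a x \<Longrightarrow> x \<le> y \<Longrightarrow> lt c a y"
  by (auto simp: lt_def split: if_splits)

lemma le_lt_trans: "x \<le> y \<Longrightarrow> lt c y a \<Longrightarrow> lt c x a"
  by (auto simp: lt_def split: if_splits)

lemma lt_trans: "lt c x y \<Longrightarrow> lt d y a \<Longrightarrow> lt c x a"
  by (auto simp: lt_def split: if_splits)

text \<open>
  The condition defining chains is imposed explicitly when \<open>r\<^sub>i = 0\<close>; otherwise it follows by
  transitivity through \<open>M\<^sup>(\<^sup>i\<^sup>)\<close>. There the first inequality is already as strict
  as the flag of the block requires.
\<close>

lemma Hstar_index_set:
  assumes "length rs = length b" and c: "c = (\<lambda>i. if i < length b then fst (b ! i) else True)"
  shows "{(m, M). length m = length b \<and> length M = length b \<and>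
      (\<forall>i<length b. length (M ! i) = rs ! i \<and> Hstar_chain c rs m M i)} =
    (SIGMA m:chains b. Hstar_lists b rs m)" (is "?L = ?R")
proof (rule set_eqI, safe)
  fix m M assume len: "length m = length b" "length M = length b"
    and *: "\<forall>i<length b. length (M ! i) = rs ! i \<and> Hstar_chain c rs m M i"
  have mem: "x \<in> Hstar_range b m i" if i: "i < length b" and x: "x \<in> set (M ! i)" for i x
  proof -
    have l: "length (M ! i) = rs ! i" and h: "Hstar_chain c rs m M i" using * i by auto
    have "M ! i \<noteq> []" using x by auto
    moreover from this have "rs ! i \<noteq> 0" using l[symmetric] by simp
    ultimately have ne: "M ! i \<noteq> []" "rs ! i \<noteq> 0" by blast+
    then have s: "sorted (M ! i)" using h by (simp add: Hstar_chain_def)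
    have hd: "hd (M ! i) \<le> x" using s ne(1) x by (cases "M ! i") auto
    have la: "x \<le> last (M ! i)" using s ne(1) x
      by (cases "M ! i" rule: rev_cases) (auto simp: sorted_append)
    have "i \<ge> 1 \<longrightarrow> lt (c i) (m ! (i - 1)) (hd (M ! i))" "lt (\<not> c (Suc i)) (last (M ! i)) (m ! i)"
      using h ne by (simp_all add: Hstar_chain_def)
    then show ?thesis unfolding mem_Hstar_range[OF i c] using lt_le_trans[OF _ hd] le_lt_trans[OF la]
      by blast
  qed
  show "m \<in> chains b" unfolding chains_def
  proof (intro CollectI conjI allI impI len(1))
    fix i assume i: "Suc i < length b"
    have h: "Hstar_chain c rs m M (Suc i)" and l: "length (M ! Suc i) = rs ! Suc i" using * i by auto
    show "lt (fst (b ! Suc i)) (m ! i) (m ! Suc i)"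
    proof (cases "rs ! Suc i = 0")
      case True
      then show ?thesis using h i by (simp add: Hstar_chain_def c)
    next
      case False
      then obtain x where "x \<in> set (M ! Suc i)" using l by (cases "M ! Suc i") auto
      from mem[OF i this] show ?thesis
        using i unfolding mem_Hstar_range[OF i c] by (auto simp: c intro: lt_trans)
    qed
  qed
  show "M \<in> Hstar_lists b rs m" unfolding Hstar_lists_def sorted_lists_def
  proof (intro CollectI conjI allI impI len(2) subsetI)
    fix i assume i: "i < length b"
    show "length (M ! i) = rs ! i" using * i by simp
    then show "sorted (M ! i)" using * i
      by (cases "rs ! i = 0") (auto simp: Hstar_chain_def)
    show "x \<in> Hstar_range b m i" if "x \<in> set (M ! i)" for x using mem[OF i that] .
  qed
next
  fix m M assume m: "m \<in> chains b" and M: "M \<in> Hstar_lists b rs m"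
  show "length m = length b" using m by (simp add: chains_def)
  show "length M = length b" using M by (simp add: Hstar_lists_def)
  fix i assume i: "i < length b"
  have Mi: "M ! i \<in> sorted_lists (rs ! i) (Hstar_range b m i)" using M i by (simp add: Hstar_lists_def)
  then show l: "length (M ! i) = rs ! i" by (simp add: sorted_lists_def)
  show "Hstar_chain c rs m M i"
  proof (cases "rs ! i = 0")
    case True
    have "lt (c i) (m ! (i - 1)) (m ! i)" if "i \<ge> 1"
      using m i that by (cases i) (auto simp: chains_def c)
    then show ?thesis using True by (simp add: Hstar_chain_def)
  next
    case False
    then have "M ! i \<noteq> []" using l by auto
    then have "hd (M ! i) \<in> Hstar_range b m i" "last (M ! i) \<in> Hstar_range b m i" "sorted (M ! i)"
      using Mi by (auto simp: sorted_lists_def)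
    then show ?thesis using False unfolding mem_Hstar_range[OF i c] by (simp add: Hstar_chain_def)
  qed
qed

definition Hstar_term ::
  "'a::real_normed_field \<Rightarrow> (bool \<times> nat) list \<Rightarrow> nat list \<Rightarrow> nat list list \<Rightarrow> 'a" where
  "Hstar_term \<alpha> b m M = fact (Suc (last m)) / pochhammer \<alpha> (Suc (last m)) *
     (chain_prod (\<lambda>m. 1 / (of_nat m + 1)) b m *
      (\<Prod>i<length b. \<Prod>j<length (M ! i). 1 / (of_nat (M ! i ! j) + \<alpha>)))"

lemma finite_Hstar_lists: "finite (Hstar_lists b rs m)"
  unfolding Hstar_lists_def
  by (rule conjunct1[OF sum_list_product[where A = "\<lambda>i. sorted_lists (rs ! i) (Hstar_range b m i)"]])
    (auto intro!: finite_sorted_lists simp: Hstar_range_def)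

lemma Hstar_eq:
  assumes "w \<noteq> []" "b = blocks w" "length rs = length b"
  shows "Hstar rs w \<alpha> =
    (\<Sum>\<^sub>\<infinity>(m, M)\<in>(SIGMA m:chains b. Hstar_lists b rs m). Hstar_term \<alpha> b m M)"
proof -
  have "Hstar rs w \<alpha> = (\<Sum>\<^sub>\<infinity>(m, M)\<in>(SIGMA m:chains b. Hstar_lists b rs m).
      fact (last m + 1) / pochhammer \<alpha> (last m + 1) *
       (\<Prod>i<length b. (\<Prod>j<rs ! i. 1 / (of_nat (M ! i ! j) + \<alpha>)) *
               (1 / of_nat (m ! i + 1) ^ snd (b ! i))))"
    using assms(1) unfolding Hstar_def Let_def assms(2)[symmetric] Hstar_index_set[OF assms(3) refl]
    by simp
  also have "\<dots> = (\<Sum>\<^sub>\<infinity>(m, M)\<in>(SIGMA m:chains b. Hstar_lists b rs m). Hstar_term \<alpha> b m M)"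
  proof (rule infsum_cong, clarify)
    fix m M assume "M \<in> Hstar_lists b rs m"
    then have l: "length (M ! i) = rs ! i" if "i < length b" for i
      using that by (simp add: Hstar_lists_def sorted_lists_def)
    have "(\<Prod>i<length b. (\<Prod>j<rs ! i. 1 / (of_nat (M ! i ! j) + \<alpha>)) *
               (1 / of_nat (m ! i + 1) ^ snd (b ! i))) =
        (\<Prod>i<length b. (\<Prod>j<length (M ! i). 1 / (of_nat (M ! i ! j) + \<alpha>)) *
               (1 / (of_nat (m ! i) + 1)) ^ snd (b ! i))"
      by (rule prod.cong) (simp_all add: l power_one_over add.commute)
    then show "fact (last m + 1) / pochhammer \<alpha> (last m + 1) *
       (\<Prod>i<length b. (\<Prod>j<rs ! i. 1 / (of_nat (M ! i ! j) + \<alpha>)) *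
               (1 / of_nat (m ! i + 1) ^ snd (b ! i))) = Hstar_term \<alpha> b m M"
      unfolding Hstar_term_def chain_prod_def
      by (simp only: Suc_eq_plus1 prod.distrib mult_ac)
  qed
  finally show ?thesis .
qed

text \<open>
  For a fixed chain the sum over \<open>M\<close> factors into complete homogeneous polynomials over consecutive
  intervals; summing over compositions multiplies their generating functions, which leaves one
  geometric series for each \<open>j \<le> last m\<close>.
\<close>

lemma Hstar_fps_nth:
  fixes \<alpha> :: "'a::real_normed_field"
  assumes "m \<in> chains b" "b \<noteq> []" "minorant \<beta> \<alpha>"
  shows "Hstar_fps \<alpha> b m $ r =
    (\<Sum>rs\<in>compositions (length b) r. \<Sum>M\<in>Hstar_lists b rs m. Hstar_term \<alpha> b m M)"
proof -
  let ?K = "fact (Suc (last m)) / pochhammer \<alpha> (Suc (last m)) * chain_prod (\<lambda>m. 1 / (of_nat m + 1)) b m"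
  let ?y = "\<lambda>j. 1 / (of_nat j + \<alpha>)"
  have len: "length b > 0" using assms(2) by simp
  have "(\<Sum>rs\<in>compositions (length b) r. \<Sum>M\<in>Hstar_lists b rs m. Hstar_term \<alpha> b m M) =
      ?K * (\<Sum>rs\<in>compositions (length b) r.
        \<Sum>M\<in>Hstar_lists b rs m. \<Prod>i<length b. \<Prod>j<length (M ! i). ?y (M ! i ! j))"
    by (simp add: Hstar_term_def sum_distrib_left mult.assoc)
  also have "(\<Sum>rs\<in>compositions (length b) r.
        \<Sum>M\<in>Hstar_lists b rs m. \<Prod>i<length b. \<Prod>j<length (M ! i). ?y (M ! i ! j)) =
      (\<Sum>rs\<in>compositions (length b) r. \<Prod>i<length b.
        (\<Prod>j\<in>Hstar_range b m i. geometric_fps (?y j)) $ (rs ! i))"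
  proof (rule sum.cong[OF refl])
    fix rs
    have fin: "finite (Hstar_range b m i)" for i by (simp add: Hstar_range_def)
    show "(\<Sum>M\<in>Hstar_lists b rs m. \<Prod>i<length b. \<Prod>j<length (M ! i). ?y (M ! i ! j)) =
        (\<Prod>i<length b. (\<Prod>j\<in>Hstar_range b m i. geometric_fps (?y j)) $ (rs ! i))"
      unfolding sum_sorted_lists[OF fin, symmetric] Hstar_lists_def
      by (rule conjunct2[OF sum_list_product]) (rule finite_sorted_lists[OF fin])
  qed
  also have "\<dots> = (\<Prod>j<Suc (last m). geometric_fps (?y j)) $ r"
    unfolding fps_prod_nth_compositions[OF len, symmetric] prod_Hstar_range[OF assms(1,2)] ..
  also have "?K * \<dots> = Hstar_fps \<alpha> b m $ r"
  proof -
    have "resolvent a = fps_const (1 / a) * geometric_fps (1 / a)" for a :: 'a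
      by (rule fps_ext) (simp add: resolvent_nth geometric_fps_def)
    moreover have "(\<Prod>j<n. fps_const (f j)) = fps_const (\<Prod>j<n. f j)" for f :: "nat \<Rightarrow> 'a" and n
      by (induction n) simp_all
    ultimately have "(\<Prod>j<n. resolvent (of_nat j + \<alpha>)) =
        fps_const (1 / pochhammer \<alpha> n) * (\<Prod>j<n. geometric_fps (?y j))" for n
      by (simp add: prod.distrib pochhammer_prod atLeast0LessThan add.commute prod_dividef)
    then show ?thesis by (simp add: Hstar_fps_def)
  qed
  finally show ?thesis by simp
qed

lemma norm_Hstar_term_le:
  assumes "minorant \<beta> \<alpha>"
  shows "norm (Hstar_term \<alpha> b m M) \<le> Hstar_term \<beta> b m M"
proof -
  have "norm (connector \<alpha> 0 (Suc (last m))) \<le> connector \<beta> 0 (Suc (last m))"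
    by (rule norm_connector_le[OF assms])
  moreover have "norm (\<Prod>i<length b. \<Prod>j<length (M ! i). 1 / (of_nat (M ! i ! j) + \<alpha>)) \<le>
      (\<Prod>i<length b. \<Prod>j<length (M ! i). 1 / (real (M ! i ! j) + \<beta>))"
    unfolding prod_norm[symmetric] using norm_wt_le[OF assms, of "Suc k" for k]
    by (intro prod_mono conjI prod_nonneg ballI norm_ge_zero) simp
  ultimately show ?thesis
    unfolding Hstar_term_def norm_mult
    using minorant_pos[OF assms]
    by (intro mult_mono mult_nonneg_nonneg norm_ge_zero norm_chain_prod_one_le)
      (auto simp: connector_def chain_prod_def intro!: prod_nonneg divide_nonneg_nonneg pochhammer_nonneg)
qed

lemma sum_Hstar:
  fixes \<alpha> :: complex
  assumes w: "w \<noteq> []" "b = blocks w" "b \<noteq> []"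
    and min: "minorant \<beta> \<alpha>" and summ: "(\<lambda>m. Hstar_fps \<beta> b m $ r) summable_on chains b"
  shows "(\<Sum>rs\<in>compositions (length b) r. Hstar rs w \<alpha>) = (\<Sum>\<^sub>\<infinity>m\<in>chains b. Hstar_fps \<alpha> b m $ r)"
proof -
  note minb = minorant_self[OF min]
  have nonneg: "Hstar_term \<beta> b m M \<ge> 0" for m M
    using order.trans[OF norm_ge_zero norm_Hstar_term_le[OF min]] .
  have "((\<lambda>m. \<Sum>rs\<in>compositions (length b) r. \<Sum>M\<in>Hstar_lists b rs m. Hstar_term \<alpha> b m M)
      has_sum (\<Sum>rs\<in>compositions (length b) r. Hstar rs w \<alpha>)) (chains b)"
  proof (rule has_sum_sum_finite[OF finite_compositions])
    fix rs assume rs: "rs \<in> compositions (length b) r"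
    have len: "length rs = length b" using rs by (simp add: compositions_def)
    have "(\<lambda>(m, M). Hstar_term \<beta> b m M) summable_on (SIGMA m:chains b. Hstar_lists b rs m)"
    proof (rule summable_on_SigmaI[where g = "\<lambda>m. \<Sum>M\<in>Hstar_lists b rs m. Hstar_term \<beta> b m M"])
      show "(\<lambda>m. \<Sum>M\<in>Hstar_lists b rs m. Hstar_term \<beta> b m M) summable_on chains b"
      proof (rule summable_on_norm_le[OF summ])
        fix m assume m: "m \<in> chains b"
        have "(\<Sum>M\<in>Hstar_lists b rs m. Hstar_term \<beta> b m M) \<le>
            (\<Sum>rs\<in>compositions (length b) r. \<Sum>M\<in>Hstar_lists b rs m. Hstar_term \<beta> b m M)"
          by (rule member_le_sum[OF rs]) (auto intro!: sum_nonneg nonneg finite_compositions)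
        also have "\<dots> = Hstar_fps \<beta> b m $ r"
          by (rule Hstar_fps_nth[OF m w(3) minb, symmetric])
        finally show "norm (\<Sum>M\<in>Hstar_lists b rs m. Hstar_term \<beta> b m M) \<le> Hstar_fps \<beta> b m $ r"
          by (simp add: sum_nonneg nonneg)
      qed
    qed (auto simp: nonneg finite_Hstar_lists)
    then have "(\<lambda>(m, M). Hstar_term \<alpha> b m M) summable_on (SIGMA m:chains b. Hstar_lists b rs m)"
      by (rule summable_on_norm_le) (auto intro: norm_Hstar_term_le[OF min])
    then have "((\<lambda>(m, M). Hstar_term \<alpha> b m M) has_sum Hstar rs w \<alpha>) (SIGMA m:chains b. Hstar_lists b rs m)"
      unfolding Hstar_eq[OF w(1,2) len] by (rule has_sum_infsum)
    then show "((\<lambda>m. \<Sum>M\<in>Hstar_lists b rs m. Hstar_term \<alpha> b m M) has_sum Hstar rs w \<alpha>) (chains b)"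
      by (rule has_sum_SigmaD) (auto simp: finite_Hstar_lists)
  qed
  then have "((\<lambda>m. Hstar_fps \<alpha> b m $ r) has_sum (\<Sum>rs\<in>compositions (length b) r. Hstar rs w \<alpha>)) (chains b)"
    by (rule has_sum_cong[THEN iffD1, rotated]) (rule Hstar_fps_nth[OF _ w(3) min, symmetric])
  then show ?thesis by (rule infsumI[symmetric])
qed

section \<open>The duality relation\<close>

theorem theorem3p1:
  fixes v :: "letter list" and r :: nat and \<alpha> :: complex
  assumes "v \<in> B0" and "Re \<alpha> > 0"
  shows "zeta (sigma_b2 r v) \<alpha> =
    (if v = [] then 1
     else \<Sum>rs\<in>compositions (length (blocks (tau v))) r. Hstar rs (tau v) \<alpha>)"
proof (cases "v = []")
  case True
  then show ?thesis by (simp add: sigma_b2_def zeta_single zeta_word_Nil)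
next
  case False
  then obtain es where v: "v = X1 # es @ [Xm1]" using assms(1) B0_iff by auto
  then have tau: "tau v = rev (map opp v)" by (simp add: tau_def)
  have ne: "tau v \<noteq> []" by (simp add: v tau_def)
  define b b' where "b = blocks v" and "b' = blocks (tau v)"
  have B: "admissible b" "zprod b = v" "admissible b'" "zprod b' = tau v"
    using zprod_blocks[OF assms(1)] zprod_blocks[OF tau_in_B0[OF assms(1)]] by (auto simp: b_def b'_def)
  have wb: "word_blocks b" "word_blocks b'"
    using B False ne by (auto simp: word_blocks_def admissible_def zprod_simps)
  note D = coefficientwise_duality[OF assms(2) wb _ _, of es r, unfolded B, OF v tau]
  have "zeta (sigma_b2 r v) \<alpha> = (\<Sum>\<^sub>\<infinity>m\<in>chains b. zeta_fps \<alpha> b m $ r)"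
    by (rule zeta_sigma_b2[OF assms(1) False b_def wb(1) minorant_Re[OF assms(2)] D(1)])
  also have "\<dots> = (\<Sum>\<^sub>\<infinity>m\<in>chains b'. Hstar_fps \<alpha> b' m $ r)"
    by (rule D(3))
  also have "\<dots> = (\<Sum>rs\<in>compositions (length b') r. Hstar rs (tau v) \<alpha>)"
    by (rule sum_Hstar[OF ne b'_def _ minorant_Re[OF assms(2)] D(2), symmetric])
      (use wb(2) in \<open>simp add: word_blocks_def\<close>)
  finally show ?thesis using False by (simp add: b'_def)
qed

end
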